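(* Let $F$ be a field in which $2$ is invertible and let $u_1,\dots,u_r$ be algebraically independent over $F$. Let $R=F(u_1,\dots,u_r)$, let $\Omega=\{\omega_a\mid a\ge0\}\subseteq R$ be admissible with $\omega_0\ne0$, and suppose that $\mathscr W_{r,2}(\mathbf u)$, where $\mathbf u=(u_1,\dots,u_r)$, is a split semisimple $R$-algebra. Then $\mathscr W_{r,2}(\mathbf u)$ has dimension $3r^2$ over $R$ if and only if $\mathscr W_{r,2}(\mathbf u)$ has an irreducible representation of dimension $r$ upon which $E=E_1$ acts non-trivially (that is, not as zero).
   Context: $\mathscr W_{r,2}(\mathbf u)$ (the cyclotomic Nazarov--Wenzl algebra for $n=2$) is the unital associative $R$-algebra with generators $S=S_1$, $E=E_1$, $X_1$, $X_2$ and relations $S^2=1$; $E^2=\omega_0E$; $X_1X_2=X_2X_1$; $SX_1-X_2S=E-1$; $X_1S-SX_2=E-1$; $EX_1^aE=\omega_aE$ for $a>0$; $ES=E=SE$; $E(X_1+X_2)=0=(X_1+X_2)E$; $(X_1-u_1)\cdots(X_1-u_r)=0$. $\Omega=\{\omega_a\mid a\ge0\}$ is admissible if $\omega_{2a+1}=\frac12\big\{-\omega_{2a}+\sum_{b=1}^{2a+1}(-1)^{b-1}\omega_{b-1}\omega_{2a+1-b}\big\}$ for all $a\ge0$. *)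

theory Defs
  imports "Jordan_Normal_Form.VS_Connect" "HOL-Algebra.Generated_Fields" "HOL-Library.Poly_Mapping"
begin

section \<open>Algebraically independent elements\<close>

text \<open>Polynomials in variables indexed by \<open>nat\<close> are finitely supported maps from monomials
  to coefficients, where a monomial is the finitely supported map of its exponents.\<close>

definition mpoly_eval :: "(nat \<Rightarrow> 'a::comm_semiring_1) \<Rightarrow> ((nat \<Rightarrow>\<^sub>0 nat) \<Rightarrow>\<^sub>0 'a) \<Rightarrow> 'a" where
  "mpoly_eval u p = (\<Sum>m\<in>Poly_Mapping.keys p. Poly_Mapping.lookup p m *
      (\<Prod>i\<in>Poly_Mapping.keys m. u i ^ Poly_Mapping.lookup m i))"

definition alg_independent :: "'a::field set \<Rightarrow> nat set \<Rightarrow> (nat \<Rightarrow> 'a) \<Rightarrow> bool" where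
  "alg_independent F I u \<longleftrightarrow>
     (\<forall>p. (\<forall>m. Poly_Mapping.lookup p m \<in> F) \<and> (\<forall>m\<in>Poly_Mapping.keys p. Poly_Mapping.keys m \<subseteq> I) \<and>
        mpoly_eval u p = 0 \<longrightarrow> p = 0)"

section \<open>Algebras given by generators and relations\<close>

text \<open>The free monoid on \<open>'g\<close>, written additively so that \<open>'g word \<Rightarrow>\<^sub>0 'a\<close>, with the
  convolution product of the library, is the free unital associative \<open>'a\<close>-algebra on \<open>'g\<close>.\<close>

datatype 'g word = Word "'g list"

instantiation word :: (type) monoid_add
begin

definition zero_word :: "'a word" where "0 = Word []"

fun plus_word :: "'a word \<Rightarrow> 'a word \<Rightarrow> 'a word" where
  "Word xs + Word ys = Word (xs @ ys)"

instance
proof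
  fix a b c :: "'a word"
  show "a + b + c = a + (b + c)" by (cases a; cases b; cases c) simp
  show "0 + a = a" "a + 0 = a" by (cases a; simp add: zero_word_def)+
qed

end

definition gen :: "'g \<Rightarrow> 'g word \<Rightarrow>\<^sub>0 'a::field" where
  "gen g = Poly_Mapping.single (Word [g]) 1"

definition scalar :: "'a::field \<Rightarrow> 'g word \<Rightarrow>\<^sub>0 'a" where
  "scalar c = Poly_Mapping.single 0 c"

text \<open>\<open>presented_class T x\<close> is the class of \<open>x\<close> modulo the two-sided ideal generated by the set of
  relators \<open>T\<close>.\<close>

definition presented_class ::
  "('g word \<Rightarrow>\<^sub>0 'a::field) set \<Rightarrow> ('g word \<Rightarrow>\<^sub>0 'a) \<Rightarrow> ('g word \<Rightarrow>\<^sub>0 'a) set" where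
  "presented_class T x = (Idl\<^bsub>class_ring\<^esub> T) +>\<^bsub>class_ring\<^esub> x"

definition presented_algebra ::
  "('g word \<Rightarrow>\<^sub>0 'a::field) set \<Rightarrow> ('a, ('g word \<Rightarrow>\<^sub>0 'a) set) module" where
  "presented_algebra T = (let Q = class_ring Quot (Idl\<^bsub>class_ring\<^esub> T) in
     \<lparr>carrier = carrier Q, mult = mult Q, one = one Q, zero = zero Q, add = add Q,
      smult = (\<lambda>c x. presented_class T (scalar c) \<otimes>\<^bsub>Q\<^esub> x)\<rparr>)"

section \<open>Representations and split semisimple algebras\<close>

text \<open>In this section \<open>A\<close> is meant to be a unital associative, not necessarily commutative,
  algebra over the field \<open>'a\<close>. A representation of dimension \<open>n\<close> is a unital algebra
  homomorphism into the \<open>n \<times> n\<close> matrices.\<close>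

definition representation :: "('a::field, 'b) module \<Rightarrow> nat \<Rightarrow> ('b \<Rightarrow> 'a mat) \<Rightarrow> bool" where
  "representation A n \<rho> \<longleftrightarrow> \<rho> \<in> Ring.ring_hom A (ring_mat TYPE('a) n ()) \<and>
     (\<forall>c. \<forall>x\<in>carrier A. \<rho> (c \<odot>\<^bsub>A\<^esub> x) = c \<cdot>\<^sub>m \<rho> x)"

definition irreducible_representation ::
  "('a::field, 'b) module \<Rightarrow> nat \<Rightarrow> ('b \<Rightarrow> 'a mat) \<Rightarrow> bool" where
  "irreducible_representation A n \<rho> \<longleftrightarrow> representation A n \<rho> \<and> n > 0 \<and>
     (\<forall>U. VectorSpace.subspace class_ring U (module_vec TYPE('a) n) \<and>
          (\<forall>x\<in>carrier A. \<forall>v\<in>U. \<rho> x *\<^sub>v v \<in> U) \<longrightarrow> U = {0\<^sub>v n} \<or> U = carrier_vec n)"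

definition left_ideal :: "('a, 'b) module \<Rightarrow> 'b set \<Rightarrow> bool" where
  "left_ideal A L \<longleftrightarrow> additive_subgroup L A \<and> (\<forall>a\<in>carrier A. \<forall>x\<in>L. a \<otimes>\<^bsub>A\<^esub> x \<in> L)"

definition simple_left_ideal :: "('a, 'b) module \<Rightarrow> 'b set \<Rightarrow> bool" where
  "simple_left_ideal A L \<longleftrightarrow> left_ideal A L \<and> L \<noteq> {\<zero>\<^bsub>A\<^esub>} \<and>
     (\<forall>L'. left_ideal A L' \<and> L' \<subseteq> L \<longrightarrow> L' = {\<zero>\<^bsub>A\<^esub>} \<or> L' = L)"

text \<open>Semisimple: the left regular module is a sum of simple submodules.\<close>

definition semisimple_algebra :: "('a, 'b) module \<Rightarrow> bool" where
  "semisimple_algebra A \<longleftrightarrow> carrier A = generate (add_monoid A) (\<Union>{L. simple_left_ideal A L})"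

text \<open>Split: every endomorphism of an irreducible representation is a scalar.\<close>

definition split_algebra :: "('a::field, 'b) module \<Rightarrow> bool" where
  "split_algebra A \<longleftrightarrow> (\<forall>n \<rho>. irreducible_representation A n \<rho> \<longrightarrow>
     (\<forall>M\<in>carrier_mat n n. (\<forall>x\<in>carrier A. M * \<rho> x = \<rho> x * M) \<longrightarrow> (\<exists>c. M = c \<cdot>\<^sub>m 1\<^sub>m n)))"

text \<open>Finite-dimensionality is included because \<^const>\<open>split_algebra\<close> sees only the
  finite-dimensional irreducible modules.\<close>

definition split_semisimple :: "('a::field, 'b) module \<Rightarrow> bool" where
  "split_semisimple A \<longleftrightarrow>
     vectorspace.fin_dim class_ring A \<and> semisimple_algebra A \<and> split_algebra A"

section \<open>The cyclotomic Nazarov--Wenzl algebra for \<open>n = 2\<close>\<close>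

definition admissible :: "(nat \<Rightarrow> 'a::field) \<Rightarrow> bool" where
  "admissible \<omega> \<longleftrightarrow> (\<forall>a. \<omega> (2 * a + 1) =
     1 / 2 * (- \<omega> (2 * a) + (\<Sum>b = 1..2 * a + 1. (-1) ^ (b - 1) * \<omega> (b - 1) * \<omega> (2 * a + 1 - b))))"

datatype nw_gen = gS | gE | gX1 | gX2

definition nw_relators ::
  "nat \<Rightarrow> (nat \<Rightarrow> 'a::field) \<Rightarrow> (nat \<Rightarrow> 'a) \<Rightarrow> (nw_gen word \<Rightarrow>\<^sub>0 'a) set" where
  "nw_relators r u \<omega> = (let S = gen gS; E = gen gE; X1 = gen gX1; X2 = gen gX2 in
     {S ^ 2 - 1,
      E ^ 2 - scalar (\<omega> 0) * E,
      X1 * X2 - X2 * X1,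
      (S * X1 - X2 * S) - (E - 1),
      (X1 * S - S * X2) - (E - 1),
      E * S - E,
      S * E - E,
      E * (X1 + X2),
      (X1 + X2) * E,
      prod_list (map (\<lambda>i. X1 - scalar (u i)) [1..<Suc r])}
     \<union> {E * X1 ^ a * E - scalar (\<omega> a) * E | a. a > 0})"

definition nw_algebra ::
  "nat \<Rightarrow> (nat \<Rightarrow> 'a::field) \<Rightarrow> (nat \<Rightarrow> 'a) \<Rightarrow> ('a, (nw_gen word \<Rightarrow>\<^sub>0 'a) set) module" where
  "nw_algebra r u \<omega> = presented_algebra (nw_relators r u \<omega>)"

definition nw_E ::
  "nat \<Rightarrow> (nat \<Rightarrow> 'a::field) \<Rightarrow> (nat \<Rightarrow> 'a) \<Rightarrow> (nw_gen word \<Rightarrow>\<^sub>0 'a) set" where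
  "nw_E r u \<omega> = presented_class (nw_relators r u \<omega>) (gen gE)"

end

theory Submission
  imports Defs
begin

text \<open>
  Let \<open>P i\<close> be the Lagrange interpolation idempotents of \<open>X1\<close> for the nodes \<open>u 1, \<dots>, u r\<close>, and
  \<open>Q j\<close> the same polynomials evaluated at \<open>X2\<close>. The algebra \<open>W\<close> is spanned by the \<open>3r\<^sup>2\<close> elements
  \<open>P i Q j\<close>, \<open>P i Q j S\<close> and \<open>P i E P j\<close>. The first two families are linearly independent modulo the
  ideal generated by \<open>E\<close>, because for generic \<open>u\<close> the quotient, a degenerate cyclotomic Hecke algebra,
  has enough one- and two-dimensional representations. Hence \<open>W\<close> has dimension \<open>3r\<^sup>2\<close> if and only if
  no \<open>P i E P j\<close> vanishes. Since \<open>E W E = R E\<close> and \<open>W E\<close> is spanned by the \<open>P i E\<close>, in the semisimple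
  case \<open>W E\<close> is then an irreducible module of dimension \<open>r\<close>. Conversely, a representation of dimension
  \<open>r\<close> generated by a vector in the image of \<open>E\<close> is spanned by \<open>r\<close> vectors, one in the image of each
  \<open>P i\<close>, so none of the \<open>P i\<close> acts as zero, and irreducibility then gives that no \<open>P i E P j\<close> does.
  All computations take place in the free algebra modulo the ideal of relations.
\<close>

section \<open>Scalars and words\<close>

text \<open>The relators contain no polynomial relation for \<open>X2\<close>, so the spanning
  argument is not symmetric: on the left the relation of \<open>X1\<close> supplies idempotents,
  while on the right only a bound on the degree in \<open>X2\<close> is available, and the relation
  must be carried across \<open>S\<close> with control of the error terms. Genericity enters only
  as: no two distinct \<open>u i\<close> differ by \<open>0\<close> or by \<open>1\<close>. For
  \<open>i \<noteq> j\<close> a two-dimensional representation isolates the coefficients of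
  \<open>P i Q j\<close> and \<open>P i Q j S\<close>. For \<open>i = j\<close> the same matrix for
  \<open>X1\<close> would have a double eigenvalue without being diagonalizable, against the simple
  roots of the relation, so two one-dimensional representations replace it, and
  \<open>2 \<noteq> 0\<close> separates them. Semisimplicity enters as: a nonzero \<open>x\<close>
  has \<open>x w x \<noteq> 0\<close> for some \<open>w\<close>. For \<open>x = y E\<close> this
  reads \<open>y (E w y E) = c y E\<close> with \<open>c \<noteq> 0\<close>, so every nonzero vector
  of \<open>W E\<close> is carried back to \<open>E\<close>, which generates. The equivalence closes
  as a circle: no \<open>P k E P l\<close> vanishes, so no \<open>P k E\<close> does, so
  \<open>W E\<close> is irreducible of dimension \<open>r\<close>, so no \<open>P k E P l\<close>
  vanishes.\<close>

lemma scalar_add: "scalar (a + b) = scalar a + scalar b"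
  by (simp add: scalar_def single_add)

lemma scalar_mult: "scalar (a * b) = scalar a * scalar b"
  by (simp add: scalar_def mult_single)

lemma scalar_0 [simp]: "scalar 0 = 0" and scalar_1 [simp]: "scalar 1 = 1"
  by (simp_all add: scalar_def)

lemma scalar_minus: "scalar (- a) = - scalar a"
  by (simp add: scalar_def single_uminus)

lemma poly_mapping_induct [case_names zero add single]:
  fixes p :: "'w \<Rightarrow>\<^sub>0 'c::comm_monoid_add"
  assumes "P 0" "\<And>x y. P x \<Longrightarrow> P y \<Longrightarrow> P (x + y)" "\<And>w c. P (Poly_Mapping.single w c)"
  shows "P p"
proof (induction p rule: update_induct)
  case const
  have "(Abs_poly_mapping (\<lambda>_. 0) :: 'w \<Rightarrow>\<^sub>0 'c) = 0" by simp
  with assms(1) show ?case by simp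
next
  case (update f a b)
  have "Poly_Mapping.update a b f = f + Poly_Mapping.single a b"
    using update by (intro poly_mapping_eqI)
      (auto simp: lookup_update lookup_add lookup_single when_def in_keys_iff)
  with update assms show ?case by simp
qed

lemma scalar_commute: "scalar c * x = x * scalar c"
  by (induction x rule: poly_mapping_induct)
    (simp_all add: scalar_def mult_single mult.commute distrib_left distrib_right)

lemma scalar_commute_left: "x * (scalar c * y) = scalar c * (x * y)"
  by (metis mult.assoc scalar_commute)

text \<open>Words grow on the right, so a property stable under sums and scalars only has to be
  checked for right multiplication by one generator at a time.\<close>

lemma free_algebra_induct [case_names one add scale gen]:
  assumes "P 1" "\<And>x y. P x \<Longrightarrow> P y \<Longrightarrow> P (x + y)" "\<And>c x. P x \<Longrightarrow> P (scalar c * x)"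
    "\<And>x g. P x \<Longrightarrow> P (x * gen g)"
  shows "P x"
proof -
  have word: "P (Poly_Mapping.single (Word gs) 1)" for gs
  proof (induction gs rule: rev_induct)
    case Nil
    then show ?case using assms(1) by (simp add: zero_word_def[symmetric])
  next
    case (snoc g gs)
    then show ?case using assms(4)[OF snoc, of g] by (simp add: gen_def mult_single)
  qed
  show ?thesis
  proof (induction x rule: poly_mapping_induct)
    case zero
    then show ?case using assms(3)[OF assms(1), of 0] by simp
  next
    case (single w c)
    obtain gs where "w = Word gs" by (cases w)
    then show ?case using assms(3)[OF word[of gs], of c] by (simp add: scalar_def mult_single)
  qed (use assms(2) in blast)
qed

text \<open>Spans are taken in the free algebra itself; adding the ideal to a generating set then
  expresses spanning in the quotient.\<close>

interpretation fa: vector_space "\<lambda>c (x :: 'g word \<Rightarrow>\<^sub>0 'a::field). scalar c * x"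
  by unfold_locales (simp_all add: distrib_left distrib_right scalar_add scalar_mult mult.assoc)

section \<open>Presented algebras\<close>

lemma ideal_Idl: "ideal (Idl\<^bsub>class_ring\<^esub> T) (class_ring :: ('b::ring_1) ring)"
  by (rule ring.genideal_ideal[OF class_ring.ring_axioms]) simp

lemma Idl_base: "x \<in> T \<Longrightarrow> x \<in> Idl\<^bsub>class_ring\<^esub> (T :: 'b::ring_1 set)"
  using ring.genideal_self[OF class_ring.ring_axioms, of T] by auto

context
  fixes T :: "'b::ring_1 set"
begin

interpretation ideal "Idl\<^bsub>class_ring\<^esub> T" "class_ring :: 'b ring"
  by (rule ideal_Idl)

lemma Idl_0 [simp]: "0 \<in> Idl\<^bsub>class_ring\<^esub> T"
  using zero_closed by simp

lemma Idl_add: "x \<in> Idl\<^bsub>class_ring\<^esub> T \<Longrightarrow> y \<in> Idl\<^bsub>class_ring\<^esub> T \<Longrightarrow> x + y \<in> Idl\<^bsub>class_ring\<^esub> T"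
  using a_closed by simp

lemma Idl_mult_left: "x \<in> Idl\<^bsub>class_ring\<^esub> T \<Longrightarrow> a * x \<in> Idl\<^bsub>class_ring\<^esub> T"
  using I_l_closed[of x a] by simp

lemma Idl_mult_right: "x \<in> Idl\<^bsub>class_ring\<^esub> T \<Longrightarrow> x * a \<in> Idl\<^bsub>class_ring\<^esub> T"
  using I_r_closed[of x a] by simp

lemma Idl_uminus: "x \<in> Idl\<^bsub>class_ring\<^esub> T \<Longrightarrow> - x \<in> Idl\<^bsub>class_ring\<^esub> T"
  using Idl_mult_left[of x "-1"] by simp

lemma Idl_diff: "x \<in> Idl\<^bsub>class_ring\<^esub> T \<Longrightarrow> y \<in> Idl\<^bsub>class_ring\<^esub> T \<Longrightarrow> x - y \<in> Idl\<^bsub>class_ring\<^esub> T"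
  using Idl_add[of x "-y"] Idl_uminus by simp

lemma Idl_sum: "(\<And>i. i \<in> A \<Longrightarrow> f i \<in> Idl\<^bsub>class_ring\<^esub> T) \<Longrightarrow> sum f A \<in> Idl\<^bsub>class_ring\<^esub> T"
  by (induction A rule: infinite_finite_induct) (auto intro: Idl_add)

end

lemma Idl_minimal:
  assumes "T \<subseteq> J" "0 \<in> J" "\<And>x y. x \<in> J \<Longrightarrow> y \<in> J \<Longrightarrow> x + y \<in> J"
    "\<And>a x. x \<in> J \<Longrightarrow> a * x \<in> J" "\<And>a x. x \<in> J \<Longrightarrow> x * a \<in> J"
  shows "Idl\<^bsub>class_ring\<^esub> T \<subseteq> (J :: 'b::ring_1 set)"
proof (rule ring.genideal_minimal[OF class_ring.ring_axioms])
  have neg: "- x \<in> J" if "x \<in> J" for x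
    using assms(4)[OF that, of "-1"] by simp
  interpret ring "class_ring :: 'b ring" by (rule class_ring.ring_axioms)
  \<comment> \<open>The subgroup axioms speak of inverses in the additive monoid written out as a
    record; these two facts identify them with \<open>uminus\<close>.\<close>
  have "a_inv (class_ring :: 'b ring) = uminus" by (simp only: class_ring_simps)
  then have [simp]: "m_inv \<lparr>carrier = UNIV, mult = (+), one = 0\<rparr> = (uminus :: 'b \<Rightarrow> 'b)"
    by (simp add: a_inv_def)
  show "ideal J class_ring"
    by (rule idealI[OF class_ring.ring_axioms], unfold_locales)
      (use assms neg in auto)
qed (use assms in simp)

context
  fixes T :: "('g word \<Rightarrow>\<^sub>0 'a::field) set"
begin

interpretation ideal "Idl\<^bsub>class_ring\<^esub> T" "class_ring :: ('g word \<Rightarrow>\<^sub>0 'a) ring"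
  by (rule ideal_Idl)

lemma presented_class_eq_iff:
  "presented_class T x = presented_class T y \<longleftrightarrow> x - y \<in> Idl\<^bsub>class_ring\<^esub> T"
proof -
  have "x \<ominus>\<^bsub>class_ring\<^esub> y = x - y" by (simp only: class_ring_simps)
  then show ?thesis
    using ring.quotient_eq_iff_same_a_r_cos[OF class_ring.ring_axioms ideal_Idl[of T], of x y]
    by (simp add: presented_class_def)
qed

lemma presented_algebra_carrier: "carrier (presented_algebra T) = range (presented_class T)"
  by (simp add: presented_algebra_def Let_def FactRing_def A_RCOSETS_def' presented_class_def
      UNION_singleton_eq_range)

lemma presented_algebra_mult:
  "presented_class T x \<otimes>\<^bsub>presented_algebra T\<^esub> presented_class T y = presented_class T (x * y)"
  using rcoset_mult_add[of x y] by (simp add: presented_algebra_def Let_def FactRing_simps presented_class_def)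

lemma presented_algebra_add:
  "presented_class T x \<oplus>\<^bsub>presented_algebra T\<^esub> presented_class T y = presented_class T (x + y)"
  using a_rcos_sum[of x y] by (simp add: presented_algebra_def Let_def FactRing_simps presented_class_def)

lemma presented_algebra_one: "\<one>\<^bsub>presented_algebra T\<^esub> = presented_class T 1"
  by (simp add: presented_algebra_def Let_def FactRing_simps presented_class_def)

lemma presented_algebra_zero: "\<zero>\<^bsub>presented_algebra T\<^esub> = presented_class T 0"
  using ring.a_rcos_zero[OF class_ring.ring_axioms ideal_Idl[of T], of 0]
  by (simp add: presented_algebra_def Let_def FactRing_simps presented_class_def)

lemma presented_algebra_smult:
  "c \<odot>\<^bsub>presented_algebra T\<^esub> presented_class T x = presented_class T (scalar c * x)"
  using presented_algebra_mult[of "scalar c" x]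
  by (simp add: presented_algebra_def Let_def)

end

lemmas presented_algebra_simps =
  presented_algebra_mult presented_algebra_add presented_algebra_one
  presented_algebra_zero presented_algebra_smult

lemma ring_presented_algebra: "ring (presented_algebra T)"
proof (rule ringI)
  show "abelian_group (presented_algebra T)"
  proof (rule abelian_groupI)
    fix x assume "x \<in> carrier (presented_algebra T)"
    then obtain a where "x = presented_class T a" by (auto simp: presented_algebra_carrier)
    then show "\<exists>y\<in>carrier (presented_algebra T). y \<oplus>\<^bsub>presented_algebra T\<^esub> x = \<zero>\<^bsub>presented_algebra T\<^esub>"
      by (intro bexI[of _ "presented_class T (- a)"])
        (auto simp: presented_algebra_simps presented_algebra_carrier)
  next
    fix x y assume "x \<in> carrier (presented_algebra T)" "y \<in> carrier (presented_algebra T)"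
    then obtain a b where "x = presented_class T a" "y = presented_class T b"
      by (auto simp: presented_algebra_carrier)
    then show "x \<oplus>\<^bsub>presented_algebra T\<^esub> y = y \<oplus>\<^bsub>presented_algebra T\<^esub> x"
      by (simp add: presented_algebra_add add.commute)
  qed (auto simp: presented_algebra_carrier presented_algebra_simps add.assoc)
  show "Group.monoid (presented_algebra T)"
    by (rule monoidI) (auto simp: presented_algebra_carrier presented_algebra_simps mult.assoc)
qed (auto simp: presented_algebra_carrier presented_algebra_simps distrib_left distrib_right)

lemma vectorspace_presented_algebra:
  "vectorspace class_ring (presented_algebra (T :: ('g word \<Rightarrow>\<^sub>0 'a::field) set))"
proof -
  interpret ring "presented_algebra T" by (rule ring_presented_algebra)
  have "Module.module class_ring (presented_algebra T)"
  proof (rule Module.module.intro[OF class_cring.cring_axioms abelian_group_axioms], unfold_locales,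
      unfold presented_algebra_carrier, goal_cases)
    case (1 a x)
    then show ?case by (auto simp: presented_algebra_smult)
  next
    case (2 a b x)
    then show ?case by (elim rangeE) (simp add: presented_algebra_simps scalar_add distrib_right)
  next
    case (3 a x y)
    then show ?case by (elim rangeE) (simp add: presented_algebra_simps distrib_left)
  next
    case (4 a b x)
    then show ?case by (elim rangeE) (simp only: presented_algebra_simps scalar_mult mult.assoc monoid.select_convs)
  next
    case (5 x)
    then show ?case by (elim rangeE) (simp add: presented_algebra_simps)
  qed
  then show ?thesis
    by (simp add: vectorspace_def class_field)
qed

text \<open>If \<open>x s \<noteq> 0\<close> for some \<open>s\<close> in a simple left ideal, then \<open>s = w x s\<close> for some \<open>w\<close>, hence
  \<open>x s = (x w x) s = 0\<close>. So \<open>x\<close> annihilates the sum of the simple left ideals, in particular \<open>1\<close>.\<close>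

lemma semisimple_presented_algebra:
  fixes T :: "('g word \<Rightarrow>\<^sub>0 'a::field) set"
  assumes ss: "semisimple_algebra (presented_algebra T)"
    and nil: "\<And>w. x * w * x \<in> Idl\<^bsub>class_ring\<^esub> T"
  shows "x \<in> Idl\<^bsub>class_ring\<^esub> T"
proof -
  let ?A = "presented_algebra T" and ?q = "presented_class T"
  interpret ring ?A by (rule ring_presented_algebra)
  have q_carrier [simp]: "?q y \<in> carrier ?A" for y
    by (auto simp: presented_algebra_carrier)
  have simple: "?q x \<otimes>\<^bsub>?A\<^esub> s = \<zero>\<^bsub>?A\<^esub>" if L: "simple_left_ideal ?A L" and s: "s \<in> L" for s L
  proof (rule ccontr)
    assume nz: "?q x \<otimes>\<^bsub>?A\<^esub> s \<noteq> \<zero>\<^bsub>?A\<^esub>"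
    have lid: "left_ideal ?A L" using L by (simp add: simple_left_ideal_def)
    then interpret L: additive_subgroup L ?A by (simp add: left_ideal_def)
    obtain a where a: "s = ?q a" using s L.a_subset by (auto simp: presented_algebra_carrier)
    let ?L' = "range (\<lambda>w. ?q (w * x * a))"
    have mem: "?q (w * x * a) \<in> L" for w
    proof -
      have "?q (w * x) \<otimes>\<^bsub>?A\<^esub> s \<in> L"
        using lid s by (simp add: left_ideal_def)
      then show ?thesis by (simp add: a presented_algebra_simps)
    qed
    have "left_ideal ?A ?L'"
      unfolding left_ideal_def
    proof (intro conjI ballI)
      have inv: "\<ominus>\<^bsub>?A\<^esub> ?q y = ?q (- y)" for y
        by (rule minus_equality) (auto simp: presented_algebra_simps)
      show "additive_subgroup ?L' ?A"
        by (rule additive_subgroup.intro, rule add.subgroupI)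
          (auto simp: presented_algebra_simps a_inv_def[symmetric] inv distrib_right[symmetric]
            intro: range_eqI[of _ _ "- _"])
      show "\<And>b y. b \<in> carrier ?A \<Longrightarrow> y \<in> ?L' \<Longrightarrow> b \<otimes>\<^bsub>?A\<^esub> y \<in> ?L'"
        by (auto simp: presented_algebra_carrier presented_algebra_simps mult.assoc[symmetric])
    qed
    moreover have "?q (1 * x * a) \<in> ?L'" by blast
    then have "?L' \<noteq> {\<zero>\<^bsub>?A\<^esub>}"
      using nz by (auto simp: a presented_algebra_simps)
    moreover have "?L' \<subseteq> L" using mem by auto
    ultimately have "?L' = L" using L unfolding simple_left_ideal_def by blast
    then obtain w where w: "s = ?q (w * x * a)" using s by auto
    have "?q x \<otimes>\<^bsub>?A\<^esub> s = ?q ((x * w * x) * a)"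
      by (simp add: w presented_algebra_simps mult.assoc)
    also have "\<dots> = ?q 0"
      using Idl_mult_right[OF nil[of w], of a] by (simp add: presented_class_eq_iff)
    finally show False using nz by (simp add: presented_algebra_simps)
  qed
  have "?q x \<otimes>\<^bsub>?A\<^esub> s = \<zero>\<^bsub>?A\<^esub> \<and> s \<in> carrier ?A"
    if "s \<in> generate (add_monoid ?A) (\<Union> {L. simple_left_ideal ?A L})" for s
    using that
  proof (induction rule: generate.induct)
    case one
    then show ?case by simp
  next
    case (incl h)
    then show ?case
      using simple by (auto simp: simple_left_ideal_def left_ideal_def dest: additive_subgroup.a_Hcarr)
  next
    case (inv h)
    then have "?q x \<otimes>\<^bsub>?A\<^esub> h = \<zero>\<^bsub>?A\<^esub> \<and> h \<in> carrier ?A"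
      using simple by (auto simp: simple_left_ideal_def left_ideal_def dest: additive_subgroup.a_Hcarr)
    then show ?case by (simp add: a_inv_def[symmetric] r_minus)
  next
    case (eng h1 h2)
    then show ?case by (simp add: r_distr)
  qed
  moreover have "\<one>\<^bsub>?A\<^esub> \<in> generate (add_monoid ?A) (\<Union> {L. simple_left_ideal ?A L})"
    using ss one_closed unfolding semisimple_algebra_def by simp
  ultimately have "?q x \<otimes>\<^bsub>?A\<^esub> \<one>\<^bsub>?A\<^esub> = \<zero>\<^bsub>?A\<^esub>" by blast
  then have "?q x = ?q 0" by (simp add: presented_algebra_zero[symmetric])
  then show ?thesis by (simp add: presented_class_eq_iff)
qed

lemma finsum_presented_algebra:
  "finsum (presented_algebra T) (\<lambda>j. presented_class T (f j)) J = presented_class T (sum f J)"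
proof -
  interpret ring "presented_algebra T" by (rule ring_presented_algebra)
  show ?thesis
    by (induction J rule: infinite_finite_induct)
      (auto simp: presented_algebra_zero presented_algebra_add presented_algebra_carrier)
qed

text \<open>The preimage of the span under the class map is a subspace of the free algebra
  containing the ideal and all \<open>b j\<close>, hence it is everything.\<close>

lemma span_presented_algebra:
  fixes T :: "('g word \<Rightarrow>\<^sub>0 'a::field) set"
  assumes span: "fa.span (Idl\<^bsub>class_ring\<^esub> T \<union> b ` J) = UNIV"
  shows "LinearCombinations.module.span class_ring (presented_algebra T) ((\<lambda>j. presented_class T (b j)) ` J)
    = carrier (presented_algebra T)"
proof -
  interpret V: vectorspace class_ring "presented_algebra T" by (rule vectorspace_presented_algebra)
  let ?B = "(\<lambda>j. presented_class T (b j)) ` J"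
  have B: "?B \<subseteq> carrier (presented_algebra T)" by (auto simp: presented_algebra_carrier)
  interpret S: submodule class_ring "V.span ?B" "presented_algebra T"
    by (rule V.span_is_submodule[OF B])
  have "Idl\<^bsub>class_ring\<^esub> T \<subseteq> {x. presented_class T x \<in> V.span ?B}"
  proof
    fix x assume "x \<in> Idl\<^bsub>class_ring\<^esub> T"
    then have "presented_class T x = \<zero>\<^bsub>presented_algebra T\<^esub>"
      by (simp add: presented_algebra_zero presented_class_eq_iff)
    then show "x \<in> {x. presented_class T x \<in> V.span ?B}" by simp
  qed
  moreover have "b ` J \<subseteq> {x. presented_class T x \<in> V.span ?B}"
    using V.in_own_span[OF B] by auto
  moreover have "fa.subspace {x. presented_class T x \<in> V.span ?B}"
  proof (rule fa.subspaceI)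
    show "0 \<in> {x. presented_class T x \<in> V.span ?B}"
      using S.zero_closed by (simp add: presented_algebra_zero)
  next
    fix x y assume "x \<in> {x. presented_class T x \<in> V.span ?B}" "y \<in> {x. presented_class T x \<in> V.span ?B}"
    then show "x + y \<in> {x. presented_class T x \<in> V.span ?B}"
      using S.m_closed[of "presented_class T x" "presented_class T y"]
      by (simp add: presented_algebra_add)
  next
    fix c x assume "x \<in> {x. presented_class T x \<in> V.span ?B}"
    then show "scalar c * x \<in> {x. presented_class T x \<in> V.span ?B}"
      using S.smult_closed[of c "presented_class T x"] by (simp add: presented_algebra_smult)
  qed
  ultimately have "fa.span (Idl\<^bsub>class_ring\<^esub> T \<union> b ` J) \<subseteq> {x. presented_class T x \<in> V.span ?B}"
    by (intro fa.span_minimal) auto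
  then have "carrier (presented_algebra T) \<subseteq> V.span ?B"
    using span by (auto simp: presented_algebra_carrier)
  then show ?thesis using S.subset by blast
qed

text \<open>A spanning family indexed by \<open>J\<close> is independent exactly when the dimension
  reaches \<open>card J\<close>. Finite-dimensionality is part of the claim because
  \<open>dim\<close> is meaningful only together with it.\<close>

lemma dim_presented_algebra_iff:
  fixes T :: "('g word \<Rightarrow>\<^sub>0 'a::field) set"
  assumes J: "finite J" and span: "fa.span (Idl\<^bsub>class_ring\<^esub> T \<union> b ` J) = UNIV"
  shows "vectorspace.fin_dim class_ring (presented_algebra T) \<and>
      vectorspace.dim class_ring (presented_algebra T) = card J \<longleftrightarrow>
    (\<forall>c. (\<Sum>j\<in>J. scalar (c j) * b j) \<in> Idl\<^bsub>class_ring\<^esub> T \<longrightarrow> (\<forall>j\<in>J. c j = 0))"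
    (is "?dim \<longleftrightarrow> ?indep")
proof -
  let ?A = "presented_algebra T" and ?g = "\<lambda>j. presented_class T (b j)" and ?I = "Idl\<^bsub>class_ring\<^esub> T"
  interpret V: vectorspace class_ring ?A by (rule vectorspace_presented_algebra)
  have g: "?g ` X \<subseteq> carrier ?A" for X by (auto simp: presented_algebra_carrier)
  note gen = span_presented_algebra[OF span]
  have fin_dim: V.fin_dim
    unfolding V.fin_dim_def by (intro exI[of _ "?g ` J"] conjI finite_imageI J g gen)
  show ?thesis
  proof
    assume dim: ?dim
    show ?indep
    proof (intro allI impI ballI, rule ccontr)
      fix c j assume c: "(\<Sum>j\<in>J. scalar (c j) * b j) \<in> ?I" and j: "j \<in> J" "c j \<noteq> 0"
      \<comment> \<open>Solving the relation for \<open>b j\<close> shows that the remaining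
        elements still span, so fewer than \<open>card J\<close> classes would generate.\<close>
      let ?X = "fa.span (?I \<union> b ` (J - {j}))"
      have "(\<Sum>i\<in>J. scalar (c i) * b i) - (\<Sum>i\<in>J - {j}. scalar (c i) * b i) \<in> ?X"
      proof (rule fa.span_diff)
        show "(\<Sum>i\<in>J. scalar (c i) * b i) \<in> ?X" using c by (intro fa.span_base) simp
        show "(\<Sum>i\<in>J - {j}. scalar (c i) * b i) \<in> ?X"
          by (rule fa.span_sum, rule fa.span_scale, rule fa.span_base) blast
      qed
      then have "scalar (c j) * b j \<in> ?X"
        using J j by (simp add: sum.remove)
      then have "scalar (1 / c j) * (scalar (c j) * b j) \<in> ?X"
        by (rule fa.span_scale)
      then have "b j \<in> ?X"
        using j by (simp add: mult.assoc[symmetric] scalar_mult[symmetric])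
      then have "?I \<union> b ` J \<subseteq> ?X"
        using fa.span_superset[of "?I \<union> b ` (J - {j})"] by blast
      then have "?X = UNIV"
        using span fa.span_minimal[OF _ fa.subspace_span, of "?I \<union> b ` J"] by auto
      then have "V.dim \<le> card (?g ` (J - {j}))"
        using J by (intro V.gen_ge_dim g span_presented_algebra) auto
      also have "\<dots> \<le> card (J - {j})" using J by (intro card_image_le) auto
      also have "\<dots> < card J" using J j by (intro psubset_card_mono) auto
      finally show False using dim by simp
    qed
  next
    assume indep: ?indep
    \<comment> \<open>Bases are sets while \<open>b\<close> is a family, so repetitions must be
      excluded: two equal classes would give a relation with coefficients \<open>1\<close> and
      \<open>- 1\<close>.\<close>
    have inj: "inj_on ?g J"
    proof (rule inj_onI, rule ccontr)
      fix i j assume ij: "i \<in> J" "j \<in> J" "?g i = ?g j" "i \<noteq> j"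
      let ?c = "(\<lambda>_. 0)(i := 1, j := - 1)"
      have "(\<Sum>k\<in>J. scalar (?c k) * b k) = (\<Sum>k\<in>{i, j}. scalar (?c k) * b k)"
        using J ij by (intro sum.mono_neutral_right) auto
      also have "\<dots> = b i - b j" using ij by (simp add: scalar_minus)
      finally have "(\<Sum>k\<in>J. scalar (?c k) * b k) \<in> ?I"
        using ij by (simp only: presented_class_eq_iff)
      then show False using indep[rule_format, of ?c j] ij(2) by simp
    qed
    have "V.lin_indpt (?g ` J)"
    proof (rule V.finite_lin_indpt2[OF _ g])
      fix a assume "V.lincomb a (?g ` J) = \<zero>\<^bsub>?A\<^esub>"
      moreover have "V.lincomb a (?g ` J) = (\<Oplus>\<^bsub>?A\<^esub>j\<in>J. a (?g j) \<odot>\<^bsub>?A\<^esub> ?g j)"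
        unfolding V.lincomb_def using inj g
        by (intro V.M.add.finprod_reindex) (auto simp: presented_algebra_smult presented_algebra_carrier)
      ultimately have "presented_class T (\<Sum>j\<in>J. scalar (a (?g j)) * b j) = presented_class T 0"
        by (simp add: presented_algebra_smult finsum_presented_algebra presented_algebra_zero)
      then have "(\<Sum>j\<in>J. scalar (a (?g j)) * b j) \<in> ?I"
        unfolding presented_class_eq_iff by simp
      then have "a (?g j) = 0" if "j \<in> J" for j
        using that by (rule indep[rule_format])
      then show "\<forall>v\<in>?g ` J. a v = \<zero>\<^bsub>class_ring\<^esub>" by simp
    qed (use J in simp)
    then have "V.basis (?g ` J)"
      unfolding V.basis_def by (intro conjI gen g)
    then have "V.dim = card (?g ` J)"
      using J by (intro V.dim_basis) auto
    then show ?dim using fin_dim by (simp add: card_image[OF inj])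
  qed
qed

lemma representation_presented_algebraD:
  fixes T :: "('g word \<Rightarrow>\<^sub>0 'a::field) set"
  assumes "representation (presented_algebra T) n \<rho>"
  shows "\<rho> (presented_class T x) \<in> carrier_mat n n"
    and "\<rho> (presented_class T (x + y)) = \<rho> (presented_class T x) + \<rho> (presented_class T y)"
    and "\<rho> (presented_class T (x * y)) = \<rho> (presented_class T x) * \<rho> (presented_class T y)"
    and "\<rho> (presented_class T 1) = 1\<^sub>m n"
    and "\<rho> (presented_class T (scalar c * x)) = c \<cdot>\<^sub>m \<rho> (presented_class T x)"
proof -
  have carrier: "presented_class T z \<in> carrier (presented_algebra T)" for z
    by (auto simp: presented_algebra_carrier)
  have hom: "\<rho> \<in> Ring.ring_hom (presented_algebra T) (ring_mat TYPE('a) n ())"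
    using assms by (simp add: representation_def)
  show "\<rho> (presented_class T x) \<in> carrier_mat n n"
    using Ring.ring_hom_closed[OF hom carrier] by (simp add: ring_mat_simps)
  show "\<rho> (presented_class T (x + y)) = \<rho> (presented_class T x) + \<rho> (presented_class T y)"
    using Ring.ring_hom_add[OF hom carrier carrier, of x y] by (simp add: ring_mat_simps presented_algebra_add)
  show "\<rho> (presented_class T (x * y)) = \<rho> (presented_class T x) * \<rho> (presented_class T y)"
    using Ring.ring_hom_mult[OF hom carrier carrier, of x y] by (simp add: ring_mat_simps presented_algebra_mult)
  show "\<rho> (presented_class T 1) = 1\<^sub>m n"
    using Ring.ring_hom_one[OF hom] by (simp add: ring_mat_simps presented_algebra_one)
  show "\<rho> (presented_class T (scalar c * x)) = c \<cdot>\<^sub>m \<rho> (presented_class T x)"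
    using assms carrier[of x] by (simp add: representation_def presented_algebra_smult[symmetric])
qed

lemma representation_presented_algebraI:
  fixes R :: "('g word \<Rightarrow>\<^sub>0 'a::field) \<Rightarrow> 'a mat"
  assumes "\<And>x y. x - y \<in> Idl\<^bsub>class_ring\<^esub> T \<Longrightarrow> R x = R y"
    and "\<And>x. R x \<in> carrier_mat n n"
    and "\<And>x y. R (x + y) = R x + R y"
    and "\<And>x y. R (x * y) = R x * R y"
    and "R 1 = 1\<^sub>m n"
    and "\<And>c x. R (scalar c * x) = c \<cdot>\<^sub>m R x"
  obtains \<rho> where "representation (presented_algebra T) n \<rho>" "\<And>x. \<rho> (presented_class T x) = R x"
proof
  \<comment> \<open>An arbitrary representative is chosen; the first assumption makes the value
    independent of the choice.\<close>
  define \<rho> where "\<rho> X = R (SOME x. presented_class T x = X)" for X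
  show \<rho>: "\<rho> (presented_class T x) = R x" for x
    unfolding \<rho>_def using someI[of "\<lambda>y. presented_class T y = presented_class T x" x]
    by (intro assms(1)) (simp add: presented_class_eq_iff)
  show "representation (presented_algebra T) n \<rho>"
    unfolding representation_def
  proof
    show "\<rho> \<in> Ring.ring_hom (presented_algebra T) (ring_mat TYPE('a) n ())"
      by (rule ring_hom_memI)
        (auto simp: ring_mat_simps presented_algebra_carrier presented_algebra_simps \<rho> assms(2-5))
    show "\<forall>c. \<forall>x\<in>carrier (presented_algebra T). \<rho> (c \<odot>\<^bsub>presented_algebra T\<^esub> x) = c \<cdot>\<^sub>m \<rho> x"
      by (auto simp: presented_algebra_carrier presented_algebra_smult \<rho> assms(6))
  qed
qed

section \<open>Algebra homomorphisms from the free algebra\<close>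

primrec word_prod :: "('g \<Rightarrow> 'b::monoid_mult) \<Rightarrow> 'g word \<Rightarrow> 'b" where
  "word_prod G (Word gs) = prod_list (map G gs)"

lemma word_prod_add: "word_prod G (v + w) = word_prod G v * word_prod G w"
  by (cases v; cases w) simp

text \<open>The universal property of the free algebra. The target is a plain ring, and the map
  \<open>sc\<close> onto central elements makes it an algebra over the field.\<close>

locale free_lift =
  fixes sc :: "'a::field \<Rightarrow> 'b::ring_1" and G :: "'g \<Rightarrow> 'b"
  assumes sc_0: "sc 0 = 0" and sc_1: "sc 1 = 1"
    and sc_add: "sc (a + b) = sc a + sc b" and sc_mult: "sc (a * b) = sc a * sc b"
    and sc_central: "sc a * y = y * sc a"
begin

definition lift :: "('g word \<Rightarrow>\<^sub>0 'a) \<Rightarrow> 'b" where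
  "lift x = (\<Sum>w\<in>Poly_Mapping.keys x. sc (Poly_Mapping.lookup x w) * word_prod G w)"

lemma lift_0 [simp]: "lift 0 = 0"
  by (simp add: lift_def)

lemma lift_single: "lift (Poly_Mapping.single w c) = sc c * word_prod G w"
  by (simp add: lift_def sc_0)

lemma lift_add: "lift (x + y) = lift x + lift y"
proof -
  \<comment> \<open>Cancellation can make the support of the sum smaller, so all three sums are
    taken over the union of the supports.\<close>
  let ?K = "Poly_Mapping.keys x \<union> Poly_Mapping.keys y"
  have eq: "lift z = (\<Sum>w\<in>?K. sc (Poly_Mapping.lookup z w) * word_prod G w)"
    if "Poly_Mapping.keys z \<subseteq> ?K" for z
    unfolding lift_def using that by (intro sum.mono_neutral_left) (auto simp: in_keys_iff sc_0)
  have "lift x + lift y = (\<Sum>w\<in>?K. sc (Poly_Mapping.lookup (x + y) w) * word_prod G w)"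
    by (simp add: eq lookup_add sc_add distrib_right sum.distrib)
  then show ?thesis using eq[of "x + y"] keys_add[of x y] by simp
qed

lemma lift_mult: "lift (x * y) = lift x * lift y"
proof (induction x rule: poly_mapping_induct)
  case (single v c)
  show ?case
  proof (induction y rule: poly_mapping_induct)
    case (single w d)
    show ?case
      by (simp add: mult_single lift_single word_prod_add sc_mult mult.assoc)
        (metis mult.assoc sc_central)
  qed (simp_all add: lift_add distrib_left)
qed (simp_all add: lift_add distrib_right)

lemma lift_scalar: "lift (scalar c) = sc c"
  by (simp add: scalar_def lift_single zero_word_def)

lemma lift_gen: "lift (gen g) = G g"
  by (simp add: gen_def lift_single sc_1)

lemma lift_1: "lift 1 = 1"
  using lift_scalar[of 1] by (simp add: sc_1)

lemma lift_minus: "lift (- x) = - lift x"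
  using lift_add[of x "- x"] by (simp add: eq_neg_iff_add_eq_0 add.commute)

lemma lift_diff: "lift (x - y) = lift x - lift y"
  using lift_add[of x "- y"] by (simp add: lift_minus)

lemma lift_sum: "lift (sum f A) = (\<Sum>i\<in>A. lift (f i))"
  by (induction A rule: infinite_finite_induct) (simp_all add: lift_add)

lemmas lift_simps = lift_add lift_mult lift_scalar lift_gen lift_1 lift_minus lift_diff

lemma lift_Idl:
  assumes "\<And>x. x \<in> T \<Longrightarrow> lift x = 0" and "x \<in> Idl\<^bsub>class_ring\<^esub> T"
  shows "lift x = 0"
proof -
  have "Idl\<^bsub>class_ring\<^esub> T \<subseteq> {x. lift x = 0}"
    by (rule Idl_minimal) (auto simp: assms(1) lift_simps)
  then show ?thesis using assms(2) by auto
qed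

end

section \<open>Two by two matrices\<close>

text \<open>With the size fixed, the matrices form a type of class \<open>ring_1\<close>, as the
  target of \<open>lift\<close> has to be.\<close>

datatype 'a m2 = M2 (m11: 'a) (m12: 'a) (m21: 'a) (m22: 'a)

instantiation m2 :: (comm_ring_1) ring_1
begin

definition "0 = M2 0 0 0 0"
definition "1 = M2 1 0 0 1"

fun plus_m2 where "M2 a b c d + M2 a' b' c' d' = M2 (a + a') (b + b') (c + c') (d + d')"
fun minus_m2 where "M2 a b c d - M2 a' b' c' d' = M2 (a - a') (b - b') (c - c') (d - d')"
fun uminus_m2 where "- M2 a b c d = M2 (- a) (- b) (- c) (- d)"
fun times_m2 where
  "M2 a b c d * M2 a' b' c' d' = M2 (a * a' + b * c') (a * b' + b * d') (c * a' + d * c') (c * b' + d * d')"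

instance
proof
  fix x y z :: "'a m2"
  show "x + y + z = x + (y + z)" "x * y * z = x * (y * z)" "(x + y) * z = x * z + y * z"
    "x * (y + z) = x * y + x * z"
    by (cases x; cases y; cases z; simp add: algebra_simps)+
  show "x + y = y + x" "x - y = x + - y"
    by (cases x; cases y; simp)+
  show "0 + x = x" "- x + x = 0" "1 * x = x" "x * 1 = x"
    by (cases x; simp add: zero_m2_def one_m2_def)+
  show "(0 :: 'a m2) \<noteq> 1" by (simp add: zero_m2_def one_m2_def)
qed

end

lemma m2_add [simp]: "m11 (x + y) = m11 x + m11 y" "m21 (x + y) = m21 x + m21 y" "m22 (x + y) = m22 x + m22 y"
  by (cases x; cases y; simp)+

definition m2_scalar :: "'a::comm_ring_1 \<Rightarrow> 'a m2" where "m2_scalar c = M2 c 0 0 c"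

lemma m2_scalar_mult [simp]:
  "m11 (m2_scalar c * x) = c * m11 x" "m21 (m2_scalar c * x) = c * m21 x" "m22 (m2_scalar c * x) = c * m22 x"
  by (cases x; simp add: m2_scalar_def)+

interpretation m2: free_lift m2_scalar G for G :: "'g \<Rightarrow> 'a::field m2"
proof
  show "m2_scalar a * y = y * m2_scalar a" for a :: 'a and y
    by (cases y) (simp add: m2_scalar_def mult.commute)
qed (simp_all add: m2_scalar_def zero_m2_def one_m2_def)

section \<open>Congruence modulo an ideal\<close>

text \<open>Calculations in the quotient are written as chains of congruences between elements of
  the free algebra, without handling cosets.\<close>

definition cong_Idl :: "'b::ring_1 set \<Rightarrow> 'b \<Rightarrow> 'b \<Rightarrow> bool" where
  "cong_Idl T x y \<longleftrightarrow> x - y \<in> Idl\<^bsub>class_ring\<^esub> T"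

lemma cong_Idl_refl [simp, intro]: "cong_Idl T x x"
  by (simp add: cong_Idl_def)

lemma cong_Idl_sym: "cong_Idl T x y \<Longrightarrow> cong_Idl T y x"
  unfolding cong_Idl_def using Idl_uminus[of "x - y" T] by simp

lemma cong_Idl_trans [trans]: "cong_Idl T x y \<Longrightarrow> cong_Idl T y z \<Longrightarrow> cong_Idl T x z"
  unfolding cong_Idl_def using Idl_add[of "x - y" T "y - z"] by simp

lemma cong_Idl_add: "cong_Idl T x x' \<Longrightarrow> cong_Idl T y y' \<Longrightarrow> cong_Idl T (x + y) (x' + y')"
  unfolding cong_Idl_def using Idl_add[of "x - x'" T "y - y'"] by (simp add: algebra_simps)

lemma cong_Idl_diff: "cong_Idl T x x' \<Longrightarrow> cong_Idl T y y' \<Longrightarrow> cong_Idl T (x - y) (x' - y')"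
  unfolding cong_Idl_def using Idl_diff[of "x - x'" T "y - y'"] by (simp add: algebra_simps)

lemma cong_Idl_uminus: "cong_Idl T x x' \<Longrightarrow> cong_Idl T (- x) (- x')"
  using cong_Idl_diff[of T 0 0 x x'] by simp

lemma cong_Idl_sum: "(\<And>i. i \<in> A \<Longrightarrow> cong_Idl T (f i) (g i)) \<Longrightarrow> cong_Idl T (sum f A) (sum g A)"
  unfolding cong_Idl_def sum_subtractf[symmetric] by (rule Idl_sum)

lemma cong_Idl_left: "cong_Idl T x y \<Longrightarrow> cong_Idl T (a * x) (a * y)"
  unfolding cong_Idl_def right_diff_distrib[symmetric] by (rule Idl_mult_left)

lemma cong_Idl_right: "cong_Idl T x y \<Longrightarrow> cong_Idl T (x * b) (y * b)"
  unfolding cong_Idl_def left_diff_distrib[symmetric] by (rule Idl_mult_right)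

lemma cong_Idl_mult: "cong_Idl T x x' \<Longrightarrow> cong_Idl T y y' \<Longrightarrow> cong_Idl T (x * y) (x' * y')"
  by (rule cong_Idl_trans[OF cong_Idl_left cong_Idl_right])

lemma cong_Idl_0_iff: "cong_Idl T x 0 \<longleftrightarrow> x \<in> Idl\<^bsub>class_ring\<^esub> T"
  by (simp add: cong_Idl_def)

lemma cong_Idl_scale_iff:
  fixes T :: "('g word \<Rightarrow>\<^sub>0 'a::field) set"
  assumes "c \<noteq> 0"
  shows "scalar c * x \<in> Idl\<^bsub>class_ring\<^esub> T \<longleftrightarrow> x \<in> Idl\<^bsub>class_ring\<^esub> T"
proof
  assume "scalar c * x \<in> Idl\<^bsub>class_ring\<^esub> T"
  then have "scalar (1 / c) * (scalar c * x) \<in> Idl\<^bsub>class_ring\<^esub> T" by (rule Idl_mult_left)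
  then show "x \<in> Idl\<^bsub>class_ring\<^esub> T"
    using assms by (simp add: mult.assoc[symmetric] scalar_mult[symmetric])
qed (rule Idl_mult_left)

section \<open>Polynomials in an element of the free algebra\<close>

text \<open>\<open>poly\<close> evaluates only inside the coefficient ring; here the coefficients
  lie in the field and the argument in a noncommutative algebra.\<close>

definition ev :: "('g word \<Rightarrow>\<^sub>0 'a::field) \<Rightarrow> 'a poly \<Rightarrow> 'g word \<Rightarrow>\<^sub>0 'a" where
  "ev x p = fold_coeffs (\<lambda>a y. scalar a + x * y) p 0"

lemma ev_0 [simp]: "ev x 0 = 0"
  by (simp add: ev_def)

lemma ev_pCons: "ev x (pCons a p) = scalar a + x * ev x p"
  by (cases "p = 0 \<and> a = 0") (auto simp: ev_def)

lemma ev_1 [simp]: "ev x 1 = 1"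
  by (simp add: one_pCons ev_pCons)

lemma ev_add: "ev x (p + q) = ev x p + ev x q"
  by (induction p q rule: poly_induct2) (simp_all add: ev_pCons scalar_add algebra_simps)

lemma ev_smult: "ev x (Polynomial.smult c p) = scalar c * ev x p"
  by (induction p) (simp_all add: ev_pCons scalar_mult distrib_left scalar_commute_left)

lemma ev_mult: "ev x (p * q) = ev x p * ev x q"
  by (induction p) (simp_all add: ev_pCons ev_add ev_smult distrib_right mult.assoc)

lemma ev_sum: "ev x (sum f A) = (\<Sum>i\<in>A. ev x (f i))"
  by (induction A rule: infinite_finite_induct) (simp_all add: ev_add)

lemma ev_diff: "ev x (p - q) = ev x p - ev x q"
  using ev_add[of x "p - q" q] by (simp add: algebra_simps)

lemma ev_minus: "ev x (- p) = - ev x p"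
  using ev_diff[of x 0 p] by simp

lemma ev_prod_list: "ev x (prod_list ps) = prod_list (map (ev x) ps)"
  by (induction ps) (simp_all add: ev_mult)

lemma ev_commute: "x * ev x p = ev x p * x"
proof -
  have "ev x (p * [:0, 1:]) = ev x ([:0, 1:] * p)" by (simp add: mult.commute)
  then show ?thesis unfolding ev_mult by (simp add: ev_pCons)
qed

lemma cong_ev_commute:
  assumes "cong_Idl T (y * x) (x * y)"
  shows "cong_Idl T (y * ev x p) (ev x p * y)"
proof (induction p)
  case (pCons a p)
  have "y * ev x (pCons a p) = y * scalar a + (y * x) * ev x p"
    by (simp add: ev_pCons distrib_left mult.assoc)
  also have "cong_Idl T \<dots> (y * scalar a + (x * y) * ev x p)"
    by (intro cong_Idl_add cong_Idl_right assms cong_Idl_refl)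
  also have "y * scalar a + (x * y) * ev x p = scalar a * y + x * (y * ev x p)"
    by (simp add: scalar_commute mult.assoc)
  also have "cong_Idl T \<dots> (scalar a * y + x * (ev x p * y))"
    by (intro cong_Idl_add cong_Idl_left pCons.IH cong_Idl_refl)
  also have "scalar a * y + x * (ev x p * y) = ev x (pCons a p) * y"
    by (simp add: ev_pCons distrib_right mult.assoc)
  finally show ?case .
qed simp

section \<open>Lagrange interpolation\<close>

locale interpolation =
  fixes N :: "nat set" and u :: "nat \<Rightarrow> 'a::field"
  assumes finite: "finite N" and inj: "inj_on u N"
begin

definition node_poly :: "'a poly" where
  "node_poly = (\<Prod>k\<in>N. [:- u k, 1:])"

definition lagrange :: "nat \<Rightarrow> 'a poly" where
  "lagrange i = (\<Prod>k\<in>N - {i}. Polynomial.smult (1 / (u i - u k)) [:- u k, 1:])"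

lemma poly_lagrange:
  assumes "i \<in> N" "j \<in> N"
  shows "poly (lagrange i) (u j) = (if i = j then 1 else 0)"
proof (cases "i = j")
  case True
  have "poly (lagrange i) (u i) = (\<Prod>k\<in>N - {i}. 1)"
    unfolding lagrange_def poly_prod
  proof (rule prod.cong[OF refl])
    fix k assume "k \<in> N - {i}"
    then have "u i - u k \<noteq> 0" using inj assms(1) by (auto simp: inj_on_def)
    then show "poly (Polynomial.smult (1 / (u i - u k)) [:- u k, 1:]) (u i) = 1"
      by (simp add: diff_divide_distrib[symmetric])
  qed
  then show ?thesis using True by simp
next
  case False
  then show ?thesis
    unfolding lagrange_def poly_prod using finite assms
    by (auto intro!: prod_zero bexI[of _ j])
qed

lemma degree_lagrange: "i \<in> N \<Longrightarrow> degree (lagrange i) < card N"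
proof -
  assume i: "i \<in> N"
  have "degree (lagrange i) \<le> (\<Sum>k\<in>N - {i}. degree (Polynomial.smult (1 / (u i - u k)) [:- u k, 1:]))"
    unfolding lagrange_def by (rule degree_prod_sum_le[OF finite_Diff[OF finite], unfolded o_def])
  also have "\<dots> \<le> (\<Sum>k\<in>N - {i}. 1)"
    by (intro sum_mono) simp
  also have "\<dots> < card N"
    using i finite card_gt_0_iff[of N] by fastforce
  finally show ?thesis .
qed

lemma poly_sum_lagrange:
  "j \<in> N \<Longrightarrow> poly (\<Sum>i\<in>N. Polynomial.smult (c i) (lagrange i)) (u j) = c j"
proof -
  assume j: "j \<in> N"
  have "poly (\<Sum>i\<in>N. Polynomial.smult (c i) (lagrange i)) (u j) = (\<Sum>i\<in>N. if i = j then c i else 0)"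
    unfolding poly_sum using j by (intro sum.cong) (simp_all add: poly_lagrange)
  then show ?thesis using j finite by simp
qed

lemma lagrange_interpolation:
  assumes "degree p < card N"
  shows "p = (\<Sum>i\<in>N. Polynomial.smult (poly p (u i)) (lagrange i))"
proof (rule poly_eqI_degree[of "u ` N"])
  show "degree p < card (u ` N)" using assms by (simp add: card_image[OF inj])
  have "degree (\<Sum>i\<in>N. Polynomial.smult (poly p (u i)) (lagrange i)) \<le> card N - 1"
    using degree_lagrange by (intro degree_sum_le finite) (force intro: order_trans[OF degree_smult_le])
  then show "degree (\<Sum>i\<in>N. Polynomial.smult (poly p (u i)) (lagrange i)) < card (u ` N)"
    using assms by (simp add: card_image[OF inj])
qed (auto simp: poly_sum_lagrange)

lemma degree_node_poly: "degree node_poly = card N" and lead_coeff_node_poly: "lead_coeff node_poly = 1"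
proof -
  show "degree node_poly = card N"
    unfolding node_poly_def by (subst degree_prod_eq_sum_degree) auto
  show "lead_coeff node_poly = 1"
    unfolding node_poly_def lead_coeff_prod by simp
qed

text \<open>The remainder modulo \<open>node_poly\<close> has degree below the number of nodes and
  vanishes at all of them, so interpolation forces it to be \<open>0\<close>.\<close>

lemma node_poly_dvd:
  assumes "N \<noteq> {}" "\<And>i. i \<in> N \<Longrightarrow> poly p (u i) = 0"
  shows "node_poly dvd p"
proof -
  have "node_poly \<noteq> 0" using lead_coeff_node_poly by auto
  then have "degree (p mod node_poly) < card N"
    using degree_mod_less[of node_poly p] assms(1) finite degree_node_poly
    by (auto simp: card_gt_0_iff)
  moreover have "poly (p mod node_poly) (u i) = 0" if "i \<in> N" for i
  proof -
    have "poly node_poly (u i) = 0"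
      unfolding node_poly_def poly_prod using that finite by (auto intro!: prod_zero bexI[of _ i])
    then show ?thesis
      using assms(2)[OF that] by (metis poly_mod)
  qed
  ultimately have "p mod node_poly = 0"
    using lagrange_interpolation[of "p mod node_poly"] by simp
  then show ?thesis by (simp add: dvd_eq_mod_eq_0)
qed

end

section \<open>A spanning set\<close>

text \<open>Keeps the index \<open>1\<close>, in \<open>{1..r}\<close> and as a tag of
  \<open>b\<close>, from being rewritten to \<open>Suc 0\<close>.\<close>

declare One_nat_def [simp del]

lemma fa_span_image:
  assumes "\<And>x y. f (x + y) = f x + f y" "\<And>c x. f (scalar c * x) = scalar c * f x"
    "\<And>x. x \<in> G \<Longrightarrow> f x \<in> fa.span H" "x \<in> fa.span G"
  shows "f x \<in> fa.span H"
proof -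
  have "f 0 = 0" using assms(2)[of 0 0] by simp
  then have "fa.subspace {x. f x \<in> fa.span H}"
    by (intro fa.subspaceI) (auto simp: assms(1,2) intro: fa.span_add fa.span_scale fa.span_zero)
  then have "fa.span G \<subseteq> {x. f x \<in> fa.span H}"
    using assms(3) by (intro fa.span_minimal) auto
  then show ?thesis using assms(4) by auto
qed

text \<open>\<open>generic\<close> records all that is used of algebraic independence: distinct
  nodes for the interpolation, and Lagrange polynomials that do not vanish at \<open>u i + 1\<close>
  and \<open>u i - 1\<close>.\<close>

locale nazarov_wenzl =
  fixes r :: nat and u \<omega> :: "nat \<Rightarrow> 'a::field"
  assumes r_pos: "r \<ge> 1"
    and generic: "\<lbrakk>i \<in> {1..r}; j \<in> {1..r}; i \<noteq> j\<rbrakk> \<Longrightarrow> u i \<noteq> u j \<and> u i \<noteq> u j + 1"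
    and two: "(2 :: 'a) \<noteq> 0"
begin

sublocale interpolation "{1..r}" u
  proof
  show "inj_on u {1..r}" using generic by (meson inj_onI)
qed simp

abbreviation T :: "(nw_gen word \<Rightarrow>\<^sub>0 'a) set" where "T \<equiv> nw_relators r u \<omega>"
abbreviation I :: "(nw_gen word \<Rightarrow>\<^sub>0 'a) set" where "I \<equiv> Idl\<^bsub>class_ring\<^esub> T"
abbreviation cong (infix "\<approx>" 50) where "x \<approx> y \<equiv> cong_Idl T x y"

abbreviation S :: "nw_gen word \<Rightarrow>\<^sub>0 'a" where "S \<equiv> gen gS"
abbreviation E :: "nw_gen word \<Rightarrow>\<^sub>0 'a" where "E \<equiv> gen gE"
abbreviation X1 :: "nw_gen word \<Rightarrow>\<^sub>0 'a" where "X1 \<equiv> gen gX1"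
abbreviation X2 :: "nw_gen word \<Rightarrow>\<^sub>0 'a" where "X2 \<equiv> gen gX2"

lemmas cong_rules = cong_Idl_refl cong_Idl_add cong_Idl_diff cong_Idl_uminus cong_Idl_left cong_Idl_right

lemma relator: "x \<in> T \<Longrightarrow> x \<in> I"
  by (rule Idl_base)

lemma relators:
  "S ^ 2 - 1 \<in> T" "E ^ 2 - scalar (\<omega> 0) * E \<in> T" "X1 * X2 - X2 * X1 \<in> T"
  "(S * X1 - X2 * S) - (E - 1) \<in> T" "(X1 * S - S * X2) - (E - 1) \<in> T"
  "E * S - E \<in> T" "S * E - E \<in> T" "E * (X1 + X2) \<in> T" "(X1 + X2) * E \<in> T"
  "prod_list (map (\<lambda>i. X1 - scalar (u i)) [1..<Suc r]) \<in> T"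
  unfolding nw_relators_def Let_def by blast+

lemma SS: "S * S \<approx> 1"
  using relator[OF relators(1)] by (simp add: cong_Idl_def power2_eq_square)

lemma EE: "E * E \<approx> scalar (\<omega> 0) * E"
  using relator[OF relators(2)] by (simp add: cong_Idl_def power2_eq_square)

lemma X1X2: "X1 * X2 \<approx> X2 * X1"
  using relator[OF relators(3)] by (simp add: cong_Idl_def)

lemma SX1: "S * X1 \<approx> X2 * S + E - 1"
  using relator[OF relators(4)] by (simp add: cong_Idl_def algebra_simps)

lemma X1S: "X1 * S \<approx> S * X2 + E - 1"
  using relator[OF relators(5)] by (simp add: cong_Idl_def algebra_simps)

lemma ES: "E * S \<approx> E"
  using relator[OF relators(6)] by (simp add: cong_Idl_def)

lemma SE: "S * E \<approx> E"
  using relator[OF relators(7)] by (simp add: cong_Idl_def)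

lemma EX2: "E * X2 \<approx> - (E * X1)"
  using relator[OF relators(8)] by (simp add: cong_Idl_def distrib_left add.commute)

lemma X2E: "X2 * E \<approx> - (X1 * E)"
  using relator[OF relators(9)] by (simp add: cong_Idl_def distrib_right add.commute)

lemma EX1E: "E * X1 ^ a * E \<approx> scalar (\<omega> a) * E"
proof (cases "a = 0")
  case True
  then show ?thesis using EE by simp
next
  case False
  then have "E * X1 ^ a * E - scalar (\<omega> a) * E \<in> T"
    unfolding nw_relators_def Let_def by blast
  then show ?thesis using relator by (simp add: cong_Idl_def)
qed

lemma SX2: "S * X2 \<approx> X1 * S - E + 1"
  using cong_Idl_diff[OF cong_Idl_sym[OF X1S] cong_Idl_refl[of T "E - 1"]] by (simp add: algebra_simps)

lemma ev_X1_node_poly_eq: "ev X1 node_poly = prod_list (map (\<lambda>k. X1 - scalar (u k)) [1..<Suc r])"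
proof -
  have "node_poly = prod_list (map (\<lambda>k. [:- u k, 1:]) [1..<Suc r])"
    unfolding node_poly_def by (subst prod.distinct_set_conv_list[symmetric])
      (simp_all add: atLeastLessThanSuc_atLeastAtMost del: upt_Suc)
  then show ?thesis
    by (simp add: ev_prod_list o_def ev_pCons scalar_minus del: upt_Suc)
qed

lemma ev_X1_node_poly: "ev X1 node_poly \<approx> 0"
  unfolding cong_Idl_0_iff ev_X1_node_poly_eq by (rule relator[OF relators(10)])

text \<open>The difference is divisible by \<open>node_poly\<close>, so a polynomial in
  \<open>X1\<close> matters only through its values at the nodes. All rules for the idempotents
  \<open>P i\<close> follow from this.\<close>

lemma ev_X1_cong:
  assumes "\<And>i. i \<in> {1..r} \<Longrightarrow> poly p (u i) = poly q (u i)"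
  shows "ev X1 p \<approx> ev X1 q"
proof -
  have "node_poly dvd p - q"
    using assms r_pos by (intro node_poly_dvd) auto
  then obtain k where "p - q = node_poly * k" ..
  then have "ev X1 p - ev X1 q = ev X1 node_poly * ev X1 k"
    by (simp add: ev_diff[symmetric] ev_mult)
  then show ?thesis
    using Idl_mult_right[OF ev_X1_node_poly[unfolded cong_Idl_0_iff]] by (simp add: cong_Idl_def)
qed

section \<open>The interpolation idempotents of \<open>X1\<close> and their analogues for
  \<open>X2\<close>\<close>

definition P :: "nat \<Rightarrow> nw_gen word \<Rightarrow>\<^sub>0 'a" where "P i = ev X1 (lagrange i)"
definition Q :: "nat \<Rightarrow> nw_gen word \<Rightarrow>\<^sub>0 'a" where "Q j = ev X2 (lagrange j)"

lemma ev_X1_sum: "ev X1 p \<approx> (\<Sum>i\<in>{1..r}. scalar (poly p (u i)) * P i)"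
proof -
  have "ev X1 p \<approx> ev X1 (\<Sum>i\<in>{1..r}. Polynomial.smult (poly p (u i)) (lagrange i))"
    by (rule ev_X1_cong) (simp only: poly_sum_lagrange)
  then show ?thesis by (simp add: ev_sum ev_smult P_def)
qed

lemma P_sum: "1 \<approx> (\<Sum>i\<in>{1..r}. P i)"
  using ev_X1_sum[of 1] by simp

text \<open>In contrast to \<open>ev_X1_sum\<close> this is an equality in the free algebra: with no
  relation for \<open>X2\<close> at hand, the degree bound takes its place.\<close>

lemma ev_X2_sum: "degree q < r \<Longrightarrow> ev X2 q = (\<Sum>j\<in>{1..r}. scalar (poly q (u j)) * Q j)"
  using arg_cong[OF lagrange_interpolation[of q], of "ev X2"] by (simp add: ev_sum ev_smult Q_def)

lemma ev_X1_P: "i \<in> {1..r} \<Longrightarrow> ev X1 p * P i \<approx> scalar (poly p (u i)) * P i"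
  unfolding P_def ev_mult[symmetric] ev_smult[symmetric] by (rule ev_X1_cong) (auto simp: poly_lagrange)

lemma P_ev_X1: "i \<in> {1..r} \<Longrightarrow> P i * ev X1 p \<approx> scalar (poly p (u i)) * P i"
  unfolding P_def ev_mult[symmetric] ev_smult[symmetric] by (rule ev_X1_cong) (auto simp: poly_lagrange)

lemma P_P: "i \<in> {1..r} \<Longrightarrow> j \<in> {1..r} \<Longrightarrow> P i * P j \<approx> scalar (if i = j then 1 else 0) * P i"
  using P_ev_X1[of i "lagrange j"] poly_lagrange[of j i] by (auto simp: P_def)

lemma X2_ev_X1: "X2 * ev X1 p \<approx> ev X1 p * X2"
  by (rule cong_ev_commute[OF cong_Idl_sym[OF X1X2]])

lemma ev_X2_X1: "ev X2 q * X1 \<approx> X1 * ev X2 q"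
  by (rule cong_Idl_sym[OF cong_ev_commute[OF X1X2]])

lemma E_X1_E: "\<exists>c. E * ev X1 p * E \<approx> scalar c * E"
proof -
  \<comment> \<open>The relators treat only powers of \<open>X1\<close>; the exponent
    \<open>n\<close> collects the factors \<open>X1\<close> that the recursion of \<open>ev\<close>
    splits off.\<close>
  have "\<exists>c. E * (X1 ^ n * ev X1 p) * E \<approx> scalar c * E" for n
  proof (induction p arbitrary: n)
    case 0
    show ?case by (rule exI[of _ 0]) simp
  next
    case (pCons a p)
    obtain c where c: "E * (X1 ^ Suc n * ev X1 p) * E \<approx> scalar c * E"
      using pCons.IH by blast
    have "X1 ^ n * ev X1 (pCons a p) = scalar a * X1 ^ n + X1 ^ Suc n * ev X1 p"
      by (simp only: ev_pCons distrib_left scalar_commute[of a "X1 ^ n"] power_Suc2 mult.assoc)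
    then have "E * (X1 ^ n * ev X1 (pCons a p)) * E
        = scalar a * (E * X1 ^ n * E) + E * (X1 ^ Suc n * ev X1 p) * E"
      by (simp only: distrib_left distrib_right mult.assoc scalar_commute_left[of E])
    also have "\<dots> \<approx> scalar a * (scalar (\<omega> n) * E) + scalar c * E"
      by (intro cong_rules EX1E c)
    also have "\<dots> = scalar (a * \<omega> n + c) * E"
      by (simp only: scalar_add scalar_mult distrib_right mult.assoc)
    finally show ?case by blast
  qed
  from this[of 0] show ?thesis by simp
qed

text \<open>\<open>X2\<close> commutes past the polynomial until it meets \<open>E\<close>, where it
  becomes \<open>- X1\<close>.\<close>

lemma E_X1_X2: "E * ev X1 p * X2 \<approx> E * ev X1 (- ([:0, 1:] * p))"
proof -
  have "E * ev X1 p * X2 = E * (ev X1 p * X2)" by (simp add: mult.assoc)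
  also have "\<dots> \<approx> E * (X2 * ev X1 p)"
    by (intro cong_rules cong_Idl_sym[OF X2_ev_X1])
  also have "\<dots> = (E * X2) * ev X1 p" by (simp add: mult.assoc)
  also have "\<dots> \<approx> - (E * X1) * ev X1 p"
    by (intro cong_rules EX2)
  also have "\<dots> = E * ev X1 (- ([:0, 1:] * p))"
    unfolding ev_minus ev_mult by (simp add: ev_pCons mult.assoc)
  finally show ?thesis .
qed

text \<open>Moving \<open>S\<close> left past one \<open>X1\<close> produces
  \<open>S X2 + E - 1\<close>. The induction hypothesis removes this \<open>S\<close>, after which
  \<open>E_X1_X2\<close> turns the \<open>X2\<close> into \<open>- X1\<close>; the new
  \<open>E\<close> is absorbed by \<open>E_X1_E\<close>.\<close>

lemma E_X1_S: "\<exists>q. E * ev X1 p * S \<approx> E * ev X1 q"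
proof (induction p)
  case 0
  show ?case by (rule exI[of _ 0]) simp
next
  case (pCons a p)
  obtain q where q: "E * ev X1 p * S \<approx> E * ev X1 q" using pCons.IH by blast
  obtain c where c: "E * ev X1 p * E \<approx> scalar c * E" using E_X1_E by blast
  have "E * ev X1 (pCons a p) * S = scalar a * (E * S) + E * ev X1 p * (X1 * S)"
    by (simp add: ev_pCons ev_commute distrib_left distrib_right mult.assoc scalar_commute_left[of E])
  also have "\<dots> \<approx> scalar a * E + E * ev X1 p * (S * X2 + E - 1)"
    by (intro cong_rules ES X1S)
  also have "\<dots> = scalar a * E + (E * ev X1 p * S * X2 + E * ev X1 p * E - E * ev X1 p)"
    by (simp add: algebra_simps)
  also have "\<dots> \<approx> scalar a * E + (E * ev X1 q * X2 + scalar c * E - E * ev X1 p)"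
    by (intro cong_rules q c)
  also have "\<dots> \<approx> scalar a * E + (E * ev X1 (- ([:0, 1:] * q)) + scalar c * E - E * ev X1 p)"
    by (intro cong_rules E_X1_X2)
  also have "\<dots> = E * ev X1 ([:a:] + (- ([:0, 1:] * q) + [:c:] - p))"
    by (simp add: ev_add ev_diff ev_minus distrib_left right_diff_distrib ev_pCons scalar_commute del: mult_pCons_left add_pCons)
  finally show ?case by blast
qed

text \<open>The elements \<open>E p(X1)\<close> are stable under right multiplication by each of the
  four generators.\<close>

lemma E_right: "\<exists>p. E * x \<approx> E * ev X1 p"
proof (induction x rule: free_algebra_induct)
  case one
  show ?case by (rule exI[of _ 1]) simp
next
  case (add x y)
  then obtain p q where "E * x \<approx> E * ev X1 p" "E * y \<approx> E * ev X1 q" by blast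
  then have "E * (x + y) \<approx> E * ev X1 (p + q)"
    by (simp add: distrib_left ev_add cong_Idl_add)
  then show ?case ..
next
  case (scale c x)
  then obtain p where "E * x \<approx> E * ev X1 p" by blast
  then have "E * (scalar c * x) \<approx> E * ev X1 (Polynomial.smult c p)"
    by (simp add: scalar_commute_left[of E] ev_smult cong_Idl_left)
  then show ?case ..
next
  case (gen x g)
  then obtain p where p: "E * x \<approx> E * ev X1 p" by blast
  have "E * (x * gen g) \<approx> E * ev X1 p * gen g"
    unfolding mult.assoc[symmetric] by (intro cong_rules p)
  moreover have "\<exists>q. E * ev X1 p * gen g \<approx> E * ev X1 q"
  proof (cases g)
    case gS
    then show ?thesis using E_X1_S by simp
  next
    case gE
    obtain c where "E * ev X1 p * E \<approx> scalar c * E" using E_X1_E by blast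
    then have "E * ev X1 p * gen g \<approx> E * ev X1 [:c:]"
      by (simp add: gE ev_pCons scalar_commute)
    then show ?thesis ..
  next
    case gX1
    have "E * ev X1 p * gen g = E * ev X1 (p * [:0, 1:])"
      unfolding ev_mult by (simp add: gX1 ev_pCons mult.assoc)
    then show ?thesis by auto
  next
    case gX2
    then show ?thesis using E_X1_X2 by auto
  qed
  ultimately show ?case by (meson cong_Idl_trans)
qed

lemma X2_X1_E: "X2 * (ev X1 p * E) \<approx> ev X1 (- (p * [:0, 1:])) * E"
proof -
  have "X2 * (ev X1 p * E) = (X2 * ev X1 p) * E" by (simp add: mult.assoc)
  also have "\<dots> \<approx> (ev X1 p * X2) * E"
    by (intro cong_rules X2_ev_X1)
  also have "\<dots> = ev X1 p * (X2 * E)" by (simp add: mult.assoc)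
  also have "\<dots> \<approx> ev X1 p * - (X1 * E)"
    by (intro cong_rules X2E)
  also have "\<dots> = ev X1 (- (p * [:0, 1:])) * E"
    unfolding ev_minus ev_mult by (simp add: ev_pCons mult.assoc)
  finally show ?thesis .
qed

lemma ev_X2_E: "\<exists>p. ev X2 q * E \<approx> ev X1 p * E"
proof (induction q)
  case 0
  show ?case by (rule exI[of _ 0]) simp
next
  case (pCons a q)
  then obtain p where p: "ev X2 q * E \<approx> ev X1 p * E" by blast
  have "ev X2 (pCons a q) * E = scalar a * E + X2 * (ev X2 q * E)"
    by (simp add: ev_pCons distrib_right mult.assoc)
  also have "\<dots> \<approx> scalar a * E + X2 * (ev X1 p * E)"
    by (intro cong_rules p)
  also have "\<dots> \<approx> scalar a * E + ev X1 (- (p * [:0, 1:])) * E"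
    by (intro cong_rules X2_X1_E)
  also have "\<dots> = ev X1 ([:a:] + - (p * [:0, 1:])) * E"
    by (simp add: ev_add ev_diff ev_minus distrib_right left_diff_distrib ev_pCons del: mult_pCons_right add_pCons)
  finally show ?case by blast
qed

section \<open>The candidate spanning family and its span\<close>

definition J :: "(nat \<times> nat \<times> nat) set" where
  "J = {0, 1, 2} \<times> {1..r} \<times> {1..r}"

text \<open>The tags \<open>0\<close>, \<open>1\<close>, \<open>2\<close> keep the three families
  apart as index sets even if some of the elements coincide.\<close>

fun b :: "nat \<times> nat \<times> nat \<Rightarrow> nw_gen word \<Rightarrow>\<^sub>0 'a" where
  "b (k, i, j) = (if k = 0 then P i * Q j else if k = 1 then P i * Q j * S else P i * E * P j)"

abbreviation M :: "(nw_gen word \<Rightarrow>\<^sub>0 'a) set" where "M \<equiv> fa.span (I \<union> b ` J)"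

lemma finite_J: "finite J" and card_J: "card J = 3 * r ^ 2"
  by (simp_all add: J_def power2_eq_square)

lemma M_cong: "x \<approx> y \<Longrightarrow> y \<in> M \<Longrightarrow> x \<in> M"
  using fa.span_add[of "x - y" "I \<union> b ` J" y] fa.span_base[of "x - y" "I \<union> b ` J"]
  by (simp add: cong_Idl_def)

lemma M_base: "i \<in> {1..r} \<Longrightarrow> j \<in> {1..r} \<Longrightarrow> P i * Q j \<in> M"
  "i \<in> {1..r} \<Longrightarrow> j \<in> {1..r} \<Longrightarrow> P i * Q j * S \<in> M"
  "i \<in> {1..r} \<Longrightarrow> j \<in> {1..r} \<Longrightarrow> P i * E * P j \<in> M"
proof -
  assume ij: "i \<in> {1..r}" "j \<in> {1..r}"
  then have "b (k, i, j) \<in> M" if "k \<in> {0, 1, 2}" for k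
    using that by (intro fa.span_base) (auto simp: J_def simp del: b.simps)
  from this[of 0] this[of 1] this[of 2]
  show "P i * Q j \<in> M" "P i * Q j * S \<in> M" "P i * E * P j \<in> M" by simp_all
qed

lemma M_image:
  assumes "\<And>x y. f (x + y) = f x + f y" "\<And>c x. f (scalar c * x) = scalar c * f x"
    "\<And>x. x \<in> I \<Longrightarrow> f x \<in> M"
    "\<And>i j. i \<in> {1..r} \<Longrightarrow> j \<in> {1..r} \<Longrightarrow> f (P i * Q j) \<in> M"
    "\<And>i j. i \<in> {1..r} \<Longrightarrow> j \<in> {1..r} \<Longrightarrow> f (P i * Q j * S) \<in> M"
    "\<And>i j. i \<in> {1..r} \<Longrightarrow> j \<in> {1..r} \<Longrightarrow> f (P i * E * P j) \<in> M" "x \<in> M"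
  shows "f x \<in> M"
proof (rule fa_span_image[OF assms(1,2)])
  fix y assume "y \<in> I \<union> b ` J"
  then show "f y \<in> M" using assms(3-6) by (auto simp: J_def)
qed (use assms(7) in auto)

text \<open>Every member of the family begins with some \<open>P i\<close>, on which a polynomial in
  \<open>X1\<close> acts by its value at \<open>u i\<close>.\<close>

lemma M_left: "x \<in> M \<Longrightarrow> ev X1 p * x \<in> M"
proof (rule M_image[of "\<lambda>x. ev X1 p * x"])
  have "ev X1 p * (P i * y) \<in> M" if "i \<in> {1..r}" "P i * y \<in> M" for i y
  proof (rule M_cong)
    show "ev X1 p * (P i * y) \<approx> scalar (poly p (u i)) * (P i * y)"
      using cong_Idl_right[OF ev_X1_P[OF that(1)], where b = y] by (simp add: mult.assoc)
  qed (intro fa.span_scale that)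
  note * = this
  fix i j assume ij: "i \<in> {1..r}" "j \<in> {1..r}"
  show "ev X1 p * (P i * Q j) \<in> M" "ev X1 p * (P i * Q j * S) \<in> M" "ev X1 p * (P i * E * P j) \<in> M"
    using *[OF ij(1), of "Q j"] *[OF ij(1), of "Q j * S"] *[OF ij(1), of "E * P j"] M_base[OF ij]
    by (simp_all add: mult.assoc)
next
  fix x assume "x \<in> I" then show "ev X1 p * x \<in> M" by (intro fa.span_base) (simp add: Idl_mult_left)
qed (simp_all add: distrib_left scalar_commute_left[of "ev X1 p"])

text \<open>The \<open>P i\<close> sum to \<open>1\<close>, so \<open>x\<close> is congruent to the
  sum of the \<open>P i * x\<close>.\<close>

lemma sum_P_mem: "(\<And>i. i \<in> {1..r} \<Longrightarrow> P i * x \<in> M) \<Longrightarrow> x \<in> M"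
proof (rule M_cong)
  have "1 * x \<approx> (\<Sum>i\<in>{1..r}. P i) * x" by (intro cong_rules P_sum)
  then show "x \<approx> (\<Sum>i\<in>{1..r}. P i * x)" by (simp add: sum_distrib_right)
qed (auto intro: fa.span_sum)

lemma M_low: "degree q < r \<Longrightarrow> ev X1 p * ev X2 q \<in> M"
  "degree q < r \<Longrightarrow> ev X1 p * ev X2 q * S \<in> M"
proof -
  assume q: "degree q < r"
  have "ev X2 q \<in> M"
  proof (rule sum_P_mem)
    fix i assume "i \<in> {1..r}"
    then show "P i * ev X2 q \<in> M"
      unfolding ev_X2_sum[OF q] sum_distrib_left scalar_commute_left[of "P i"] by (intro fa.span_sum fa.span_scale M_base)
  qed
  then show "ev X1 p * ev X2 q \<in> M" by (rule M_left)
  have "ev X2 q * S \<in> M"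
  proof (rule sum_P_mem)
    fix i assume "i \<in> {1..r}"
    have eq: "P i * (ev X2 q * S) = (\<Sum>j\<in>{1..r}. scalar (poly q (u j)) * (P i * Q j * S))"
      unfolding ev_X2_sum[OF q]
      by (simp add: sum_distrib_left sum_distrib_right mult.assoc scalar_commute_left[of "P i"])
    from \<open>i \<in> {1..r}\<close> show "P i * (ev X2 q * S) \<in> M"
      unfolding eq by (intro fa.span_sum fa.span_scale M_base)
  qed
  then show "ev X1 p * ev X2 q * S \<in> M" unfolding mult.assoc by (rule M_left)
qed

lemma M_E: "ev X1 p * E * ev X1 q \<in> M"
proof -
  have "E * ev X1 q \<in> M"
  proof (rule M_cong)
    show "E * ev X1 q \<approx> (\<Sum>j\<in>{1..r}. scalar (poly q (u j)) * (E * P j))"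
      using cong_Idl_left[OF ev_X1_sum[of q], of E] by (simp add: sum_distrib_left scalar_commute_left[of E])
    have "E * P j \<in> M" if "j \<in> {1..r}" for j
      by (rule sum_P_mem) (use that M_base(3) in \<open>simp add: mult.assoc\<close>)
    then show "(\<Sum>j\<in>{1..r}. scalar (poly q (u j)) * (E * P j)) \<in> M"
      by (intro fa.span_sum fa.span_scale)
  qed
  then show ?thesis unfolding mult.assoc by (rule M_left)
qed

end

section \<open>Reduction of high powers of \<open>X2\<close>, and closure of the span\<close>

context nazarov_wenzl
begin

text \<open>\<open>K\<close> is a filtration by the degree in \<open>X2\<close>. As \<open>S p(X1) = p(X2) S\<close> up to terms of lower degree, the
  relation of degree \<open>r\<close> for \<open>X1\<close> allows \<open>X2 ^ r\<close> to be reduced.\<close>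

definition K :: "nat \<Rightarrow> (nw_gen word \<Rightarrow>\<^sub>0 'a) set" where
  "K n = fa.span (I \<union> {ev X1 p * X2 ^ k | p k. k < n} \<union> {ev X1 p * E * ev X1 q | p q. True})"

lemma K_base: "x \<in> I \<Longrightarrow> x \<in> K n" "k < n \<Longrightarrow> ev X1 p * X2 ^ k \<in> K n" "ev X1 p * E * ev X1 q \<in> K n"
  unfolding K_def by (rule fa.span_base, blast)+

lemma K_cong: "x \<approx> y \<Longrightarrow> y \<in> K n \<Longrightarrow> x \<in> K n"
  using fa.span_add[of "x - y" _ y] K_base(1)[of "x - y" n] by (simp add: K_def cong_Idl_def)

lemma K_image:
  assumes "\<And>x y. f (x + y) = f x + f y" "\<And>c x. f (scalar c * x) = scalar c * f x"
    "\<And>x. x \<in> I \<Longrightarrow> f x \<in> fa.span H"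
    "\<And>p k. k < n \<Longrightarrow> f (ev X1 p * X2 ^ k) \<in> fa.span H"
    "\<And>p q. f (ev X1 p * E * ev X1 q) \<in> fa.span H" "x \<in> K n"
  shows "f x \<in> fa.span H"
  using assms(6) unfolding K_def
  by (rule fa_span_image[OF assms(1,2), rotated]) (use assms(3-5) in auto)

text \<open>On the terms without \<open>E\<close> the degree in \<open>X2\<close> grows by one; on
  the terms with \<open>E\<close> the new \<open>X2\<close> becomes \<open>- X1\<close> and nothing
  grows.\<close>

lemma K_X2: "x \<in> K n \<Longrightarrow> X2 * x \<in> K (Suc n)"
  unfolding K_def[of "Suc n"]
proof (rule K_image[of "\<lambda>x. X2 * x" _ n], unfold K_def[of "Suc n", symmetric])
  fix p k assume "k < n"
  have "X2 * ev X1 p * X2 ^ k \<approx> ev X1 p * X2 * X2 ^ k"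
    by (intro cong_rules X2_ev_X1)
  then have "X2 * (ev X1 p * X2 ^ k) \<approx> ev X1 p * X2 ^ Suc k"
    by (simp add: mult.assoc)
  then show "X2 * (ev X1 p * X2 ^ k) \<in> K (Suc n)"
    by (rule K_cong) (use \<open>k < n\<close> in \<open>intro K_base; simp\<close>)
next
  fix p q
  have "X2 * (ev X1 p * E) * ev X1 q \<approx> ev X1 (- (p * [:0, 1:])) * E * ev X1 q"
    by (intro cong_rules X2_X1_E)
  then show "X2 * (ev X1 p * E * ev X1 q) \<in> K (Suc n)"
    unfolding mult.assoc[symmetric] by (rule K_cong) (rule K_base)
qed (simp_all add: distrib_left scalar_commute_left[of X2] K_base(1) Idl_mult_left)

lemma S_ev_X1: "S * ev X1 p - ev X2 p * S \<in> K (degree p)"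
proof (induction p)
  case 0
  show ?case by (simp add: K_base(1))
next
  case (pCons a p)
  show ?case
  \<comment> \<open>\<open>pCons a 0\<close> has degree \<open>0\<close> instead of
    \<open>Suc (degree 0)\<close>, so constants need the stronger bound; they commute with
    \<open>S\<close> exactly.\<close>
  proof (cases "p = 0")
    case True
    then show ?thesis by (simp add: ev_pCons scalar_commute K_base(1))
  next
    case False
    let ?D = "S * ev X1 p - ev X2 p * S"
    have "S * ev X1 (pCons a p) - ev X2 (pCons a p) * S = (S * X1) * ev X1 p - X2 * (ev X2 p * S)"
      by (simp add: ev_pCons algebra_simps scalar_commute)
    also have "\<dots> \<approx> (X2 * S + E - 1) * ev X1 p - X2 * (ev X2 p * S)"
      by (intro cong_rules SX1)
    also have "\<dots> = X2 * ?D + ev X1 1 * E * ev X1 p - ev X1 p * X2 ^ 0"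
      by (simp add: algebra_simps)
    finally have *: "S * ev X1 (pCons a p) - ev X2 (pCons a p) * S
      \<approx> X2 * ?D + ev X1 1 * E * ev X1 p - ev X1 p * X2 ^ 0" .
    have "X2 * ?D + ev X1 1 * E * ev X1 p - ev X1 p * X2 ^ 0 \<in> K (Suc (degree p))"
      using K_X2[OF pCons.IH] K_base(3)[of 1 p "Suc (degree p)"] K_base(2)[of 0 "Suc (degree p)" p]
      unfolding K_def by (intro fa.span_add fa.span_diff) simp_all
    with * have "S * ev X1 (pCons a p) - ev X2 (pCons a p) * S \<in> K (Suc (degree p))"
      by (rule K_cong)
    then show ?thesis using False by simp
  qed
qed

lemma ev_monom: "ev x (Polynomial.monom 1 k) = x ^ k"
  by (induction k) (simp_all add: monom_0 monom_Suc ev_pCons)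

lemma K_subset_M: "x \<in> K r \<Longrightarrow> x \<in> M"
proof (rule K_image[of "\<lambda>x. x" _ r])
  fix p k assume "k < r"
  then show "ev X1 p * X2 ^ k \<in> M"
    using M_low(1)[of "Polynomial.monom 1 k" p] by (simp add: ev_monom degree_monom_eq)
qed (simp_all add: M_E fa.span_base)

lemma K_S_subset_M: "x \<in> K r \<Longrightarrow> x * S \<in> M"
proof (rule K_image[of "\<lambda>x. x * S" _ r])
  fix p k assume "k < r"
  then show "ev X1 p * X2 ^ k * S \<in> M"
    using M_low(2)[of "Polynomial.monom 1 k" p] by (simp add: ev_monom degree_monom_eq)
next
  fix p q
  obtain q' where q': "E * ev X1 q * S \<approx> E * ev X1 q'" using E_X1_S by blast
  show "ev X1 p * E * ev X1 q * S \<in> M"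
  proof (rule M_cong)
    show "ev X1 p * E * ev X1 q * S \<approx> ev X1 p * E * ev X1 q'"
      using cong_Idl_left[OF q', of "ev X1 p"] by (simp add: mult.assoc)
  qed (rule M_E)
qed (simp_all add: distrib_right mult.assoc fa.span_base Idl_mult_right)

text \<open>\<open>S node_poly(X1)\<close> vanishes, so \<open>node_poly(X2) S\<close> is, up to
  sign, the error term in \<open>K r\<close>. One more factor \<open>S\<close> on the right gives
  \<open>node_poly(X2)\<close> itself.\<close>

lemma node_poly_X2: "ev X2 node_poly \<in> M" "ev X2 node_poly * S \<in> M"
proof -
  let ?D = "S * ev X1 node_poly - ev X2 node_poly * S"
  have D: "?D \<in> K r" using S_ev_X1[of node_poly] by (simp add: degree_node_poly)
  have S0: "S * ev X1 node_poly \<in> I"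
    using ev_X1_node_poly by (intro Idl_mult_left) (simp add: cong_Idl_0_iff)
  have neg: "ev X2 node_poly * S \<approx> - ?D"
    using S0 Idl_uminus by (simp add: cong_Idl_def)
  have minus: "- x \<in> M" if "x \<in> M" for x
    using fa.span_diff[OF fa.span_zero that] by simp
  show "ev X2 node_poly * S \<in> M"
    by (rule M_cong[OF neg minus[OF K_subset_M[OF D]]])
  show "ev X2 node_poly \<in> M"
  proof (rule M_cong)
    have "ev X2 node_poly * 1 \<approx> ev X2 node_poly * (S * S)"
      by (intro cong_rules cong_Idl_sym[OF SS])
    also have "\<dots> = (ev X2 node_poly * S) * S" by (simp add: mult.assoc)
    also have "\<dots> \<approx> - ?D * S" by (intro cong_rules neg)
    finally show "ev X2 node_poly \<approx> - (?D * S)" by (simp only: mult_1_right mult_minus_left)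
  qed (rule minus[OF K_S_subset_M[OF D]])
qed

text \<open>Degree \<open>r\<close> suffices for \<open>M_right\<close>: the Lagrange polynomials
  have degree below \<open>r\<close>, and a generator contributes at most one further
  \<open>X2\<close>.\<close>

lemma M_high:
  assumes "degree q \<le> r"
  shows "ev X1 p * ev X2 q \<in> M" "ev X1 p * ev X2 q * S \<in> M"
proof -
  \<comment> \<open>The coefficient at \<open>r\<close>, not the leading one: if \<open>q\<close>
    has lower degree, \<open>c\<close> is \<open>0\<close> and nothing is subtracted.\<close>
  define c where "c = poly.coeff q r"
  define q' where "q' = q - Polynomial.smult c node_poly"
  have "q' = 0 \<or> degree q' < r"
  proof (rule disjCI)
    assume "\<not> degree q' < r"
    moreover have "degree q' \<le> r"
      unfolding q'_def using assms degree_node_poly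
      by (intro degree_diff_le order_trans[OF degree_smult_le]) simp_all
    ultimately have "lead_coeff q' = poly.coeff q' r" by simp
    also have "\<dots> = 0"
      using lead_coeff_node_poly degree_node_poly by (simp add: q'_def c_def)
    finally show "q' = 0" by simp
  qed
  then have q': "degree q' < r" using r_pos by auto
  have q: "ev X2 q = ev X2 q' + scalar c * ev X2 node_poly"
    by (simp add: q'_def ev_diff ev_smult)
  have "ev X1 p * ev X2 q = ev X1 p * ev X2 q' + scalar c * (ev X1 p * ev X2 node_poly)"
    by (simp add: q distrib_left scalar_commute_left[of "ev X1 p"])
  then show "ev X1 p * ev X2 q \<in> M"
    using M_low(1)[OF q', of p] M_left[OF node_poly_X2(1), of p] by (simp add: fa.span_add fa.span_scale)
  have "ev X1 p * ev X2 q * S = ev X1 p * ev X2 q' * S + scalar c * (ev X1 p * (ev X2 node_poly * S))"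
    by (simp add: q distrib_left distrib_right mult.assoc scalar_commute_left[of "ev X1 p"])
  then show "ev X1 p * ev X2 q * S \<in> M"
    using M_low(2)[OF q', of p] M_left[OF node_poly_X2(2), of p] by (simp add: fa.span_add fa.span_scale)
qed

lemma M_X2_X1: "degree q \<le> r \<Longrightarrow> ev X1 p * ev X2 q * X1 \<in> M"
proof (rule M_cong)
  have "ev X1 p * (ev X2 q * X1) \<approx> ev X1 p * (X1 * ev X2 q)"
    by (intro cong_rules ev_X2_X1)
  then show "ev X1 p * ev X2 q * X1 \<approx> ev X1 (p * [:0, 1:]) * ev X2 q"
    unfolding ev_mult by (simp add: ev_pCons mult.assoc)
qed (rule M_high)

lemma M_X2_E: "ev X1 p * ev X2 q * E \<in> M"
proof -
  obtain q' where q': "ev X2 q * E \<approx> ev X1 q' * E" using ev_X2_E by blast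
  show ?thesis
  proof (rule M_cong)
    show "ev X1 p * ev X2 q * E \<approx> ev X1 (p * q') * E * ev X1 1"
      using cong_Idl_left[OF q', of "ev X1 p"] by (simp add: ev_mult mult.assoc)
  qed (rule M_E)
qed

text \<open>A generator \<open>X1\<close> or \<open>X2\<close> is first moved left past
  \<open>S\<close>, which exchanges the two and leaves terms without \<open>S\<close>. After a
  factor \<open>E\<close>, \<open>E_right\<close> absorbs any generator.\<close>

lemma M_right: "x \<in> M \<Longrightarrow> x * gen g \<in> M"
proof (rule M_image[of "\<lambda>x. x * gen g"])
  fix i j assume ij: "i \<in> {1..r}" "j \<in> {1..r}"
  then have deg: "degree (lagrange j) < r" using degree_lagrange[of j] by simp
  then have deg': "degree (lagrange j * [:0, 1:]) \<le> r"
    by (cases "lagrange j = 0") (simp_all add: degree_mult_eq)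
  have X2: "ev X1 p * ev X2 (lagrange j) * X2 = ev X1 p * ev X2 (lagrange j * [:0, 1:])" for p
    unfolding ev_mult by (simp add: ev_pCons mult.assoc)
  show "P i * Q j * gen g \<in> M"
  proof (cases g)
    case gX2
    then show ?thesis unfolding P_def Q_def X2 gX2 by (intro M_high deg')
  qed (use deg in \<open>simp_all add: P_def Q_def M_low(2) M_X2_E M_X2_X1\<close>)
  show "P i * Q j * S * gen g \<in> M"
  proof (cases g)
    case gS
    show ?thesis
    proof (rule M_cong)
      have "P i * Q j * (S * S) \<approx> P i * Q j * 1" by (intro cong_rules SS)
      then show "P i * Q j * S * gen g \<approx> P i * Q j" by (simp add: gS mult.assoc)
    qed (rule M_base[OF ij])
  next
    case gE
    show ?thesis
    proof (rule M_cong)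
      have "P i * Q j * (S * E) \<approx> P i * Q j * E" by (intro cong_rules SE)
      then show "P i * Q j * S * gen g \<approx> P i * Q j * E" by (simp add: gE mult.assoc)
    qed (simp add: P_def Q_def M_X2_E)
  next
    case gX1
    show ?thesis
    proof (rule M_cong)
      have "P i * Q j * (S * X1) \<approx> P i * Q j * (X2 * S + E - 1)" by (intro cong_rules SX1)
      then show "P i * Q j * S * gen g \<approx> P i * Q j * X2 * S + P i * Q j * E - P i * Q j"
        by (simp add: gX1 algebra_simps)
      show "P i * Q j * X2 * S + P i * Q j * E - P i * Q j \<in> M"
        unfolding P_def Q_def X2
        by (intro fa.span_add fa.span_diff M_high deg' M_X2_E M_low deg)
    qed
  next
    case gX2
    show ?thesis
    proof (rule M_cong)
      have "P i * Q j * (S * X2) \<approx> P i * Q j * (X1 * S - E + 1)" by (intro cong_rules SX2)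
      also have "\<dots> = P i * (Q j * X1) * S - P i * Q j * E + P i * Q j"
        by (simp add: algebra_simps)
      also have "\<dots> \<approx> P i * (X1 * Q j) * S - P i * Q j * E + P i * Q j"
        unfolding Q_def by (intro cong_rules ev_X2_X1)
      also have "\<dots> = ev X1 (lagrange i * [:0, 1:]) * ev X2 (lagrange j) * S - P i * Q j * E + P i * Q j"
        unfolding ev_mult by (simp add: P_def Q_def ev_pCons mult.assoc)
      finally show "P i * Q j * S * gen g
        \<approx> ev X1 (lagrange i * [:0, 1:]) * ev X2 (lagrange j) * S - P i * Q j * E + P i * Q j"
        by (simp add: gX2 mult.assoc)
      show "ev X1 (lagrange i * [:0, 1:]) * ev X2 (lagrange j) * S - P i * Q j * E + P i * Q j \<in> M"
        unfolding P_def Q_def by (intro fa.span_add fa.span_diff M_X2_E M_low deg)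
    qed
  qed
  obtain p where p: "E * (P j * gen g) \<approx> E * ev X1 p" using E_right by blast
  show "P i * E * P j * gen g \<in> M"
  proof (rule M_cong)
    show "P i * E * P j * gen g \<approx> ev X1 (lagrange i) * E * ev X1 p"
      using cong_Idl_left[OF p, of "P i"] by (simp add: mult.assoc P_def)
  qed (rule M_E)
qed (simp_all add: distrib_right mult.assoc fa.span_base Idl_mult_right)

lemma M_UNIV: "M = UNIV"
proof -
  have "x \<in> M" for x
  proof (induction x rule: free_algebra_induct)
    case one
    show ?case using M_low(1)[of 1 1] r_pos by simp
  qed (simp_all add: fa.span_add fa.span_scale M_right)
  then show ?thesis by blast
qed

text \<open>Read off from the spanning family: multiplied by \<open>E\<close> on the right, each
  member collapses to a polynomial in \<open>X1\<close> times \<open>E\<close>. A direct induction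
  would need words growing on the left.\<close>

lemma E_left: "\<exists>p. x * E \<approx> ev X1 p * E"
proof -
  let ?L = "fa.span (I \<union> {ev X1 p * E | p. True})"
  have mem: "y \<in> ?L" if "y \<approx> ev X1 p * E" for y p
  proof -
    have "y - ev X1 p * E \<in> ?L" using that by (intro fa.span_base) (simp add: cong_Idl_def)
    moreover have "ev X1 p * E \<in> ?L" by (rule fa.span_base) blast
    ultimately show ?thesis using fa.span_add by fastforce
  qed
  have "x \<in> M" by (simp add: M_UNIV)
  then have "x * E \<in> ?L"
  proof (rule fa_span_image[of "\<lambda>x. x * E", rotated -1])
    fix y assume "y \<in> I \<union> b ` J"
    then consider "y \<in> I" | i j where "y = P i * Q j" | i j where "y = P i * Q j * S"
      | i j where "y = P i * E * P j"
      by (auto simp: J_def)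
    then show "y * E \<in> ?L"
    proof cases
      case 1
      then show ?thesis by (intro fa.span_base) (simp add: Idl_mult_right)
    next
      case (2 i j)
      obtain q where q: "Q j * E \<approx> ev X1 q * E" using ev_X2_E unfolding Q_def by blast
      have "y * E \<approx> ev X1 (lagrange i * q) * E"
        using cong_Idl_left[OF q, of "P i"] by (simp add: 2 ev_mult mult.assoc P_def)
      then show ?thesis by (rule mem)
    next
      case (3 i j)
      obtain q where q: "Q j * E \<approx> ev X1 q * E" using ev_X2_E unfolding Q_def by blast
      have "P i * Q j * (S * E) \<approx> P i * Q j * E" by (intro cong_rules SE)
      also have "\<dots> = P i * (Q j * E)" by (simp add: mult.assoc)
      also have "\<dots> \<approx> P i * (ev X1 q * E)" by (intro cong_rules q)
      finally have "y * E \<approx> ev X1 (lagrange i * q) * E" by (simp add: 3 ev_mult mult.assoc P_def)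
      then show ?thesis by (rule mem)
    next
      case (4 i j)
      obtain c where c: "E * P j * E \<approx> scalar c * E" using E_X1_E unfolding P_def by blast
      have "y * E \<approx> ev X1 (Polynomial.smult c (lagrange i)) * E"
        using cong_Idl_left[OF c, of "P i"] 
        by (simp add: 4 ev_smult mult.assoc P_def scalar_commute_left[of "ev X1 (lagrange i)"])
      then show ?thesis by (rule mem)
    qed
  qed (simp_all add: distrib_right mult.assoc)
  moreover have "\<exists>p. y \<approx> ev X1 p * E" if "y \<in> ?L" for y
    using that
  proof (induction rule: fa.span_induct_alt)
    case base
    show ?case by (rule exI[of _ 0]) simp
  next
    case (step c x y)
    obtain p where p: "y \<approx> ev X1 p * E" using step by blast
    have "\<exists>q. x \<approx> ev X1 q * E"
      using step(1) by (auto simp: cong_Idl_0_iff intro: exI[of _ 0])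
    then obtain q where q: "x \<approx> ev X1 q * E" by blast
    have "scalar c * x + y \<approx> scalar c * (ev X1 q * E) + ev X1 p * E"
      by (intro cong_rules p q)
    also have "\<dots> = ev X1 (Polynomial.smult c q + p) * E"
      by (simp add: ev_add ev_smult distrib_right mult.assoc)
    finally show ?case by blast
  qed
  ultimately show ?thesis by blast
qed

end

section \<open>Independence modulo \<open>E\<close>\<close>

lemma m2_zero [simp]: "m11 0 = 0" "m21 0 = 0" "m22 0 = 0"
  by (simp_all add: zero_m2_def)

lemma m2_lift_scalar: "m2.lift G (scalar c) = M2 c 0 0 c"
  unfolding m2.lift_scalar by (simp add: m2_scalar_def)

lemmas m2_lift_simps = m2.lift_add m2.lift_mult m2_lift_scalar m2.lift_1 m2.lift_minus m2.lift_diff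

text \<open>The upper right entry may stay unknown, since only the other three entries are ever read
  off.\<close>

lemma lift_ev_triangular:
  assumes "m2.lift G x = M2 a s 0 d"
  shows "\<exists>t. m2.lift G (ev x p) = M2 (poly p a) t 0 (poly p d)"
proof (induction p)
  case 0
  show ?case by (simp add: zero_m2_def)
next
  case (pCons c p)
  then show ?case by (auto simp: ev_pCons m2_lift_simps assms)
qed

context nazarov_wenzl
begin

text \<open>Sending \<open>E\<close> to \<open>0\<close> kills every relator that is a left or right
  multiple of \<open>E\<close>; what remains are the relations of the degenerate cyclotomic Hecke
  algebra.\<close>

lemma lift_relators_eq_0:
  assumes "G gE = 0" "G gS * G gS = 1" "G gX1 * G gX2 = G gX2 * G gX1"
    "G gS * G gX1 - G gX2 * G gS = - 1" "G gX1 * G gS - G gS * G gX2 = - 1"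
    "m2.lift G (ev X1 node_poly) = 0" and x: "x \<in> I"
  shows "m2.lift G x = 0"
proof (rule m2.lift_Idl[OF _ x])
  fix x assume "x \<in> T"
  then show "m2.lift G x = 0"
    unfolding nw_relators_def Let_def ev_X1_node_poly_eq[symmetric]
    by (auto simp: m2.lift_simps assms power2_eq_square)
qed

text \<open>In the basis \<open>v, S v\<close>, where \<open>X1 v = u j v\<close> and \<open>X2 v = u i v\<close>, the relations with \<open>E = 0\<close> force the
  following matrices; only for \<open>i \<noteq> j\<close> do they satisfy the polynomial relation for \<open>X1\<close>.\<close>

lemma lift_off_diagonal:
  assumes ij: "i \<in> {1..r}" "j \<in> {1..r}" "i \<noteq> j"
  defines "G \<equiv> (\<lambda>g. case g of gS \<Rightarrow> M2 0 1 1 0 | gE \<Rightarrow> 0 | gX1 \<Rightarrow> M2 (u j) (- 1) 0 (u i)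
    | gX2 \<Rightarrow> M2 (u i) 1 0 (u j))"
  shows "x \<in> I \<Longrightarrow> m2.lift G x = 0"
    and "t \<in> J \<Longrightarrow> m22 (m2.lift G (b t)) = (if t = (0, i, j) then 1 else 0)"
    and "t \<in> J \<Longrightarrow> m21 (m2.lift G (b t)) = (if t = (1, i, j) then 1 else 0)"
proof -
  have X1: "m2.lift G X1 = M2 (u j) (- 1) 0 (u i)" and X2: "m2.lift G X2 = M2 (u i) 1 0 (u j)"
    and S: "m2.lift G S = M2 0 1 1 0" and E: "m2.lift G E = 0"
    by (simp_all add: m2.lift_gen G_def)
  show "m2.lift G x = 0" if "x \<in> I"
  proof (rule lift_relators_eq_0[OF _ _ _ _ _ _ that])
    \<comment> \<open>For \<open>i \<noteq> j\<close> both factors occur, and their product is the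
      characteristic polynomial of the matrix for \<open>X1\<close>.\<close>
    have "node_poly = [:- u j, 1:] * ([:- u i, 1:] * (\<Prod>k\<in>{1..r} - {j} - {i}. [:- u k, 1:]))"
      unfolding node_poly_def using ij
      by (subst prod.remove[of _ j], simp, simp, subst prod.remove[of _ i]) simp_all
    then have "m2.lift G (ev X1 node_poly) = m2.lift G (ev X1 [:- u j, 1:]) * m2.lift G (ev X1 [:- u i, 1:])
      * m2.lift G (ev X1 (\<Prod>k\<in>{1..r} - {j} - {i}. [:- u k, 1:]))"
      by (simp only: ev_mult m2.lift_mult mult.assoc)
    also have "m2.lift G (ev X1 [:- u j, 1:]) * m2.lift G (ev X1 [:- u i, 1:]) = 0"
      by (simp add: ev_pCons m2_lift_simps X1 zero_m2_def)
    finally show "m2.lift G (ev X1 node_poly) = 0" by simp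
  qed (simp_all add: G_def zero_m2_def one_m2_def algebra_simps)
  \<comment> \<open>\<open>P i' Q j'\<close> is upper triangular and \<open>S\<close> exchanges its
    columns. Hence the lower right entry sees only the tag \<open>0\<close> and the lower left entry
    only the tag \<open>1\<close>, while the tag \<open>2\<close> dies with
    \<open>E\<close>.\<close>
  have val: "m22 (m2.lift G (b (k, i', j'))) = (if k = 0 \<and> i' = i \<and> j' = j then 1 else 0)"
      "m21 (m2.lift G (b (k, i', j'))) = (if k = 1 \<and> i' = i \<and> j' = j then 1 else 0)"
    if k: "i' \<in> {1..r}" "j' \<in> {1..r}" for k i' j'
  proof -
    obtain s where s: "m2.lift G (P i') = M2 (poly (lagrange i') (u j)) s 0 (poly (lagrange i') (u i))"
      using lift_ev_triangular[OF X1] unfolding P_def by blast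
    obtain s' where s': "m2.lift G (Q j') = M2 (poly (lagrange j') (u i)) s' 0 (poly (lagrange j') (u j))"
      using lift_ev_triangular[OF X2] unfolding Q_def by blast
    have "m22 (m2.lift G (b (k, i', j')))
        = (if k = 0 then poly (lagrange i') (u i) * poly (lagrange j') (u j) else 0)"
      "m21 (m2.lift G (b (k, i', j')))
        = (if k = 1 then poly (lagrange i') (u i) * poly (lagrange j') (u j) else 0)"
      by (simp_all add: m2_lift_simps s s' S E)
    then show "m22 (m2.lift G (b (k, i', j'))) = (if k = 0 \<and> i' = i \<and> j' = j then 1 else 0)"
      "m21 (m2.lift G (b (k, i', j'))) = (if k = 1 \<and> i' = i \<and> j' = j then 1 else 0)"
      using k ij by (simp_all add: poly_lagrange del: b.simps)
  qed
  assume "t \<in> J"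
  then obtain k i' j' where t: "t = (k, i', j')" "i' \<in> {1..r}" "j' \<in> {1..r}"
    by (auto simp: J_def)
  show "m22 (m2.lift G (b t)) = (if t = (0, i, j) then 1 else 0)"
    "m21 (m2.lift G (b t)) = (if t = (1, i, j) then 1 else 0)"
    using val[OF t(2,3), of k] by (simp_all add: t(1) del: b.simps)
qed

text \<open>The direct sum of the two one-dimensional representations \<open>S = \<plusminus>1\<close>, \<open>X1 = u i\<close>, \<open>X2 = u i \<plusminus> 1\<close>.\<close>

lemma lift_diagonal:
  assumes i: "i \<in> {1..r}"
  defines "G \<equiv> (\<lambda>g. case g of gS \<Rightarrow> M2 1 0 0 (- 1) | gE \<Rightarrow> 0 | gX1 \<Rightarrow> M2 (u i) 0 0 (u i)
    | gX2 \<Rightarrow> M2 (u i + 1) 0 0 (u i - 1))"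
  shows "x \<in> I \<Longrightarrow> m2.lift G x = 0"
    and "(k, i', j) \<in> J \<Longrightarrow> m11 (m2.lift G (b (k, i', j)))
      = (if i' = i \<and> k < 2 then poly (lagrange j) (u i + 1) else 0)"
    and "(k, i', j) \<in> J \<Longrightarrow> m22 (m2.lift G (b (k, i', j)))
      = (if i' = i \<and> k < 2 then (if k = 0 then 1 else - 1) * poly (lagrange j) (u i - 1) else 0)"
proof -
  have X1: "m2.lift G X1 = M2 (u i) 0 0 (u i)" and X2: "m2.lift G X2 = M2 (u i + 1) 0 0 (u i - 1)"
    and S: "m2.lift G S = M2 1 0 0 (- 1)" and E: "m2.lift G E = 0"
    by (simp_all add: m2.lift_gen G_def)
  show "m2.lift G x = 0" if "x \<in> I"
  proof (rule lift_relators_eq_0[OF _ _ _ _ _ _ that])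
    have "node_poly = [:- u i, 1:] * (\<Prod>k\<in>{1..r} - {i}. [:- u k, 1:])"
      unfolding node_poly_def using i by (subst prod.remove[of _ i]) simp_all
    then have "m2.lift G (ev X1 node_poly) = m2.lift G (ev X1 [:- u i, 1:])
      * m2.lift G (ev X1 (\<Prod>k\<in>{1..r} - {i}. [:- u k, 1:]))"
      by (simp only: ev_mult m2.lift_mult)
    also have "m2.lift G (ev X1 [:- u i, 1:]) = 0"
      by (simp add: ev_pCons m2_lift_simps X1 zero_m2_def)
    finally show "m2.lift G (ev X1 node_poly) = 0" by simp
  qed (simp_all add: G_def zero_m2_def one_m2_def algebra_simps)
  assume k: "(k, i', j) \<in> J"
  obtain s where s: "m2.lift G (P i') = M2 (poly (lagrange i') (u i)) s 0 (poly (lagrange i') (u i))"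
    using lift_ev_triangular[OF X1] unfolding P_def by blast
  obtain s' where s': "m2.lift G (Q j) = M2 (poly (lagrange j) (u i + 1)) s' 0 (poly (lagrange j) (u i - 1))"
    using lift_ev_triangular[OF X2] unfolding Q_def by blast
  have "m11 (m2.lift G (b (k, i', j)))
      = (if k < 2 then poly (lagrange i') (u i) * poly (lagrange j) (u i + 1) else 0)"
    "m22 (m2.lift G (b (k, i', j))) = (if k < 2 then
      (if k = 0 then 1 else - 1) * poly (lagrange i') (u i) * poly (lagrange j) (u i - 1) else 0)"
    using k by (auto simp: J_def m2_lift_simps s s' S E)
  moreover have "i' \<in> {1..r}" using k by (simp add: J_def)
  ultimately show "m11 (m2.lift G (b (k, i', j))) = (if i' = i \<and> k < 2 then poly (lagrange j) (u i + 1) else 0)"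
    "m22 (m2.lift G (b (k, i', j)))
      = (if i' = i \<and> k < 2 then (if k = 0 then 1 else - 1) * poly (lagrange j) (u i - 1) else 0)"
    using i by (simp_all add: poly_lagrange del: b.simps)
qed

text \<open>The factors of these values are \<open>(u i + 1 - u k) / (u i - u k)\<close> and
  \<open>(u i - 1 - u k) / (u i - u k)\<close>, so \<open>generic\<close> is applied with both
  orders of the indices.\<close>

lemma poly_lagrange_shift: "i \<in> {1..r} \<Longrightarrow> poly (lagrange i) (u i + 1) \<noteq> 0 \<and> poly (lagrange i) (u i - 1) \<noteq> 0"
proof -
  assume i: "i \<in> {1..r}"
  have "u i - u k \<noteq> 0 \<and> u i + 1 - u k \<noteq> 0 \<and> u i - 1 - u k \<noteq> 0" if "k \<in> {1..r} - {i}" for k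
    using generic[of i k] generic[of k i] i that by (auto simp: algebra_simps)
  then show ?thesis
    unfolding lagrange_def poly_prod by (simp add: diff_divide_distrib[symmetric] add_divide_distrib[symmetric])
qed

lemma lift_sum_J:
  assumes "m2.lift G (\<Sum>t\<in>J. scalar (c t) * b t) = 0"
  shows "(\<Sum>t\<in>J. c t * m11 (m2.lift G (b t))) = 0"
    "(\<Sum>t\<in>J. c t * m21 (m2.lift G (b t))) = 0"
    "(\<Sum>t\<in>J. c t * m22 (m2.lift G (b t))) = 0"
proof -
  have sum: "f (\<Sum>t\<in>A. g t) = (\<Sum>t\<in>A. f (g t))"
    if "\<And>x y. f (x + y) = f x + f y" "f 0 = 0" for f :: "'a m2 \<Rightarrow> 'a" and g A
    by (induction A rule: infinite_finite_induct) (simp_all add: that)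
  have 0: "(\<Sum>t\<in>J. m2_scalar (c t) * m2.lift G (b t)) = 0"
    using assms by (simp add: m2.lift_sum m2.lift_mult m2.lift_scalar)
  show "(\<Sum>t\<in>J. c t * m11 (m2.lift G (b t))) = 0"
    using arg_cong[OF 0, of m11] by (simp add: sum del: b.simps)
  show "(\<Sum>t\<in>J. c t * m21 (m2.lift G (b t))) = 0"
    using arg_cong[OF 0, of m21] by (simp add: sum del: b.simps)
  show "(\<Sum>t\<in>J. c t * m22 (m2.lift G (b t))) = 0"
    using arg_cong[OF 0, of m22] by (simp add: sum del: b.simps)
qed

text \<open>The two-dimensional representations remove all coefficients with
  \<open>i \<noteq> j\<close>. Then the representations \<open>S = 1\<close> and
  \<open>S = - 1\<close> at \<open>u i\<close> give the sum and the difference of the last two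
  coefficients, up to nonzero factors.\<close>

lemma hecke_indep:
  assumes Z: "(\<Sum>t\<in>J. scalar (c t) * b t) \<in> I" and ij: "i \<in> {1..r}" "j \<in> {1..r}" and k: "k < 2"
  shows "c (k, i, j) = 0"
proof -
  have off: "c (0, i, j) = 0 \<and> c (1, i, j) = 0" if ij: "i \<in> {1..r}" "j \<in> {1..r}" "i \<noteq> j" for i j
  proof -
    have "(0, i, j) \<in> J" "(1, i, j) \<in> J" using ij by (auto simp: J_def)
    then show ?thesis
      using lift_sum_J(2,3)[OF lift_off_diagonal(1)[OF ij Z]] lift_off_diagonal(2,3)[OF ij] finite_J
      by (simp add: if_distrib[of "\<lambda>x. _ * x"] cong: if_cong sum.cong del: b.simps)
  qed
  have diag: "c (0, i, i) = 0 \<and> c (1, i, i) = 0" if i: "i \<in> {1..r}" for i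
  proof -
    \<comment> \<open>The value of \<open>S ^ k\<close> in the representation with
      \<open>S = - 1\<close>.\<close>
    define f :: "nat \<Rightarrow> 'a" where "f k = (if k = 0 then 1 else - 1)" for k
    let ?G = "(\<lambda>g. case g of gS \<Rightarrow> M2 1 0 0 (- 1)
      | gE \<Rightarrow> 0 | gX1 \<Rightarrow> M2 (u i) 0 0 (u i) | gX2 \<Rightarrow> M2 (u i + 1) 0 0 (u i - 1))"
    have sub: "{(0, i, i), (1, i, i)} \<subseteq> J" using i by (auto simp: J_def)
    note lift = lift_sum_J(1,3)[OF lift_diagonal(1)[OF i Z]]
    have "(\<Sum>t\<in>{(0, i, i), (1, i, i)}. c t * (poly (lagrange i) (u i + 1)))
      = (\<Sum>t\<in>J. c t * m11 (m2.lift ?G (b t)))"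
    proof (rule sum.mono_neutral_cong_left[OF finite_J sub])
      \<comment> \<open>A term not killed by the representation has first index \<open>i\<close> and
        tag below \<open>2\<close>; outside the two exceptions its second index differs from
        \<open>i\<close>, so \<open>off\<close> applies.\<close>
      show "\<forall>t\<in>J - {(0, i, i), (1, i, i)}. c t * m11 (m2.lift ?G (b t)) = 0"
      proof
        fix t assume t: "t \<in> J - {(0, i, i), (1, i, i)}"
        then obtain k i' j where t': "t = (k, i', j)" "i' \<in> {1..r}" "j \<in> {1..r}"
          by (auto simp: J_def)
        then show "c t * m11 (m2.lift ?G (b t)) = 0"
          using t off[of i j] lift_diagonal(2)[OF i, of k i' j]
          by (cases "i' = i \<and> k < 2") (auto simp: less_2_cases_iff[folded One_nat_def] simp del: b.simps)
      qed
    qed (use sub in \<open>auto simp: lift_diagonal(2)[OF i] simp del: b.simps\<close>)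
    then have 1: "(c (0, i, i) + c (1, i, i)) * poly (lagrange i) (u i + 1) = 0"
      unfolding lift(1) by (simp add: distrib_right)
    have "(\<Sum>t\<in>{(0, i, i), (1, i, i)}. c t * (f (fst t) * poly (lagrange i) (u i - 1)))
      = (\<Sum>t\<in>J. c t * m22 (m2.lift ?G (b t)))"
    proof (rule sum.mono_neutral_cong_left[OF finite_J sub])
      show "\<forall>t\<in>J - {(0, i, i), (1, i, i)}. c t * m22 (m2.lift ?G (b t)) = 0"
      proof
        fix t assume t: "t \<in> J - {(0, i, i), (1, i, i)}"
        then obtain k i' j where t': "t = (k, i', j)" "i' \<in> {1..r}" "j \<in> {1..r}"
          by (auto simp: J_def)
        then show "c t * m22 (m2.lift ?G (b t)) = 0"
          using t off[of i j] lift_diagonal(3)[OF i, of k i' j]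
          by (cases "i' = i \<and> k < 2") (auto simp: less_2_cases_iff[folded One_nat_def] simp del: b.simps)
      qed
    qed (use sub in \<open>auto simp: lift_diagonal(3)[OF i] f_def simp del: b.simps\<close>)
    then have 2: "(c (0, i, i) - c (1, i, i)) * poly (lagrange i) (u i - 1) = 0"
      unfolding lift(2) by (simp add: f_def algebra_simps)
    from 1 2 have "c (0, i, i) + c (1, i, i) = 0" "c (0, i, i) = c (1, i, i)"
      using poly_lagrange_shift[OF i] by simp_all
    moreover from this have "2 * c (0, i, i) = 0" by simp
    ultimately show ?thesis using two by simp
  qed
  show ?thesis
    using off[OF ij] diag[OF ij(1)] k by (cases "i = j") (auto simp: less_2_cases_iff[folded One_nat_def])
qed

text \<open>A vanishing \<open>P k E P l\<close> is itself a relation. Conversely, after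
  \<open>hecke_indep\<close> only the third family is left, and multiplying by \<open>P k\<close> on
  the left and \<open>P l\<close> on the right isolates one term of it.\<close>

lemma indep_iff:
  "(\<forall>c. (\<Sum>t\<in>J. scalar (c t) * b t) \<in> I \<longrightarrow> (\<forall>t\<in>J. c t = 0)) \<longleftrightarrow>
    (\<forall>k\<in>{1..r}. \<forall>l\<in>{1..r}. P k * E * P l \<notin> I)"
proof (intro iffI ballI allI impI notI)
  fix k l assume indep: "\<forall>c. (\<Sum>t\<in>J. scalar (c t) * b t) \<in> I \<longrightarrow> (\<forall>t\<in>J. c t = 0)"
    and kl: "k \<in> {1..r}" "l \<in> {1..r}" and PEP: "P k * E * P l \<in> I"
  let ?c = "(\<lambda>t. if t = (2, k, l) then 1 else 0)"
  have J: "(2, k, l) \<in> J" using kl by (simp add: J_def)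
  have "(\<Sum>t\<in>J. scalar (?c t) * b t) = (\<Sum>t\<in>J. if t = (2, k, l) then b t else 0)"
    by (rule sum.cong) (simp_all del: b.simps)
  also have "\<dots> = P k * E * P l" using J finite_J by simp
  finally show False using indep[rule_format, of ?c, OF _ J] PEP by simp
next
  fix c t assume PEP: "\<forall>k\<in>{1..r}. \<forall>l\<in>{1..r}. P k * E * P l \<notin> I"
    and Z: "(\<Sum>t\<in>J. scalar (c t) * b t) \<in> I" and "t \<in> J"
  then obtain m k l where t: "t = (m, k, l)" "m \<in> {0, 1, 2}" "k \<in> {1..r}" "l \<in> {1..r}"
    by (auto simp: J_def)
  show "c t = 0"
  proof (cases "m = 2")
    case False
    then show ?thesis using hecke_indep[OF Z t(3,4), of m] t(1,2) by auto
  next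
    case True
    have summand: "P k * (scalar (c s) * b s) * P l \<approx> (if s = t then scalar (c t) * (P k * E * P l) else 0)"
      if sJ: "s \<in> J" for s
    proof -
      obtain n i j where s: "s = (n, i, j)" "n \<in> {0, 1, 2}" "i \<in> {1..r}" "j \<in> {1..r}"
        using sJ by (auto simp: J_def)
      show ?thesis
      proof (cases "n = 2")
        case False
        then have "c s = 0" "s \<noteq> t" using hecke_indep[OF Z s(3,4), of n] s(1,2) t(1) True by auto
        then show ?thesis by simp
      next
        case n: True
        have "P k * (scalar (c s) * b s) * P l = scalar (c s) * (P k * P i * E * (P j * P l))"
          by (simp add: s n mult.assoc scalar_commute_left[of "P k"])
        also have "\<dots> \<approx> scalar (c s) * ((scalar (if k = i then 1 else 0) * P k) * E * (scalar (if j = l then 1 else 0) * P j))"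
          by (intro cong_Idl_mult cong_Idl_refl P_P s t)
        also have "\<dots> = (if s = t then scalar (c t) * (P k * E * P l) else 0)"
          using n True by (auto simp: s(1) t(1))
        finally show ?thesis .
      qed
    qed
    have "P k * (\<Sum>t\<in>J. scalar (c t) * b t) * P l = (\<Sum>s\<in>J. P k * (scalar (c s) * b s) * P l)"
      by (simp only: sum_distrib_left sum_distrib_right)
    also have "\<dots> \<approx> (\<Sum>s\<in>J. if s = t then scalar (c t) * (P k * E * P l) else 0)"
      by (intro cong_Idl_sum summand)
    also have "\<dots> = scalar (c t) * (P k * E * P l)"
      using \<open>t \<in> J\<close> finite_J by simp
    finally have "scalar (c t) * (P k * E * P l) \<approx> P k * (\<Sum>t\<in>J. scalar (c t) * b t) * P l"
      by (rule cong_Idl_sym)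
    also have "\<dots> \<approx> 0"
      unfolding cong_Idl_0_iff by (intro Idl_mult_left Idl_mult_right Z)
    finally show "c t = 0"
      using cong_Idl_scale_iff[of "c t" "P k * E * P l" T] PEP t by (auto simp: cong_Idl_0_iff)
  qed
qed

end

section \<open>Representations on which \<open>E\<close> does not vanish\<close>

lemma mat_eq_0I:
  fixes A :: "'a::semiring_1 mat"
  assumes A: "A \<in> carrier_mat m n" and 0: "\<And>v. v \<in> carrier_vec n \<Longrightarrow> A *\<^sub>v v = 0\<^sub>v m"
  shows "A = 0\<^sub>m m n"
proof (rule eq_matI)
  fix i j assume ij: "i < dim_row (0\<^sub>m m n)" "j < dim_col (0\<^sub>m m n)"
  have "(A *\<^sub>v unit_vec n j) $ i = A $$ (i, j)"
    using A ij by (simp add: carrier_matD)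
  then show "A $$ (i, j) = 0\<^sub>m m n $$ (i, j)"
    using 0[of "unit_vec n j"] ij by simp
qed (use A in auto)

lemma smult_mat_mult_vec:
  fixes A :: "'a::comm_semiring_1 mat"
  assumes "A \<in> carrier_mat m n" "v \<in> carrier_vec n"
  shows "(c \<cdot>\<^sub>m A) *\<^sub>v v = c \<cdot>\<^sub>v (A *\<^sub>v v)"
  using assms by (intro eq_vecI) (auto simp: scalar_prod_def sum_distrib_left mult.assoc)

text \<open>The images of \<open>v\<close> form an invariant subspace, which contains
  \<open>v\<close> and hence is nonzero.\<close>

lemma irreducible_representation_cyclic:
  fixes T :: "('g word \<Rightarrow>\<^sub>0 'a::field) set"
  assumes irr: "irreducible_representation (presented_algebra T) n \<rho>"
    and v: "v \<in> carrier_vec n" "v \<noteq> 0\<^sub>v n" and w: "w \<in> carrier_vec n"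
  shows "\<exists>x. w = \<rho> (presented_class T x) *\<^sub>v v"
proof -
  have rep: "representation (presented_algebra T) n \<rho>"
    using irr by (simp add: irreducible_representation_def)
  note R = representation_presented_algebraD[OF rep]
  let ?U = "range (\<lambda>x. \<rho> (presented_class T x) *\<^sub>v v)"
  have "submodule class_ring ?U (module_vec TYPE('a) n)"
  proof (rule submodule.intro[OF vec_module])
    show "?U \<subseteq> carrier (module_vec TYPE('a) n)"
      using v(1) by (auto simp: module_vec_simps intro: mult_mat_vec_carrier[OF R(1)])
    show "\<zero>\<^bsub>module_vec TYPE('a) n\<^esub> \<in> ?U"
    proof (rule range_eqI)
      show "\<zero>\<^bsub>module_vec TYPE('a) n\<^esub> = \<rho> (presented_class T (scalar 0 * 1)) *\<^sub>v v"
        unfolding R(5) R(4) using v(1) by (auto simp: module_vec_simps)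
    qed
  next
    fix y z assume "y \<in> ?U" "z \<in> ?U"
    then obtain a b where ab: "y = \<rho> (presented_class T a) *\<^sub>v v" "z = \<rho> (presented_class T b) *\<^sub>v v"
      by blast
    show "y \<oplus>\<^bsub>module_vec TYPE('a) n\<^esub> z \<in> ?U"
      using R(1) v(1) by (intro range_eqI[of _ _ "a + b"])
        (simp add: ab R(2) module_vec_simps add_mult_distrib_mat_vec[of _ n n])
  next
    fix c y assume "y \<in> ?U"
    then obtain a where a: "y = \<rho> (presented_class T a) *\<^sub>v v" by blast
    show "c \<odot>\<^bsub>module_vec TYPE('a) n\<^esub> y \<in> ?U"
      using R(1)[of a] v(1) by (intro range_eqI[of _ _ "scalar c * a"])
        (simp add: a R(5) module_vec_simps smult_mat_mult_vec)
  qed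
  then have "VectorSpace.subspace class_ring ?U (module_vec TYPE('a) n)"
    by (simp add: VectorSpace.subspace_def vec_vs)
  moreover have "\<forall>x\<in>carrier (presented_algebra T). \<forall>y\<in>?U. \<rho> x *\<^sub>v y \<in> ?U"
  proof (intro ballI)
    fix x y assume "x \<in> carrier (presented_algebra T)" "y \<in> ?U"
    then obtain a b where ab: "x = presented_class T a" "y = \<rho> (presented_class T b) *\<^sub>v v"
      by (auto simp: presented_algebra_carrier)
    show "\<rho> x *\<^sub>v y \<in> ?U"
      using R(1) v(1) by (intro range_eqI[of _ _ "a * b"]) (simp add: ab R(3) assoc_mult_mat_vec[of _ n n _ n])
  qed
  ultimately have "?U = {0\<^sub>v n} \<or> ?U = carrier_vec n"
    using irr by (simp add: irreducible_representation_def)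
  moreover have "v \<in> ?U"
    using v(1) by (intro range_eqI[of _ _ 1]) (simp add: R(4))
  ultimately have "?U = carrier_vec n" using v(2) by blast
  then show ?thesis using w by auto
qed

context nazarov_wenzl
begin

section \<open>The spaces \<open>P k W E\<close>, \<open>E W P l\<close> and \<open>E W E\<close>
  are at most one-dimensional\<close>

lemma P_left_E:
  assumes "k \<in> {1..r}"
  shows "\<exists>c. P k * x * E \<approx> scalar c * (P k * E)"
proof -
  obtain p where p: "x * E \<approx> ev X1 p * E" using E_left by blast
  have "P k * x * E = P k * (x * E)" by (simp add: mult.assoc)
  also have "\<dots> \<approx> P k * (ev X1 p * E)" by (intro cong_rules p)
  also have "\<dots> = (P k * ev X1 p) * E" by (simp add: mult.assoc)
  also have "\<dots> \<approx> (scalar (poly p (u k)) * P k) * E" by (intro cong_rules P_ev_X1 assms)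
  also have "\<dots> = scalar (poly p (u k)) * (P k * E)" by (simp add: mult.assoc)
  finally show ?thesis by blast
qed

lemma P_right_E:
  assumes "l \<in> {1..r}"
  shows "\<exists>c. E * x * P l \<approx> scalar c * (E * P l)"
proof -
  obtain p where p: "E * x \<approx> E * ev X1 p" using E_right by blast
  have "E * x * P l \<approx> (E * ev X1 p) * P l" by (intro cong_rules p)
  also have "\<dots> = E * (ev X1 p * P l)" by (simp add: mult.assoc)
  also have "\<dots> \<approx> E * (scalar (poly p (u l)) * P l)" by (intro cong_rules ev_X1_P assms)
  also have "\<dots> = scalar (poly p (u l)) * (E * P l)" by (rule scalar_commute_left)
  finally show ?thesis by blast
qed

lemma E_E: "\<exists>c. E * x * E \<approx> scalar c * E"
proof -
  obtain p where p: "E * x \<approx> E * ev X1 p" using E_right by blast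
  obtain c where c: "E * ev X1 p * E \<approx> scalar c * E" using E_X1_E by blast
  have "E * x * E \<approx> E * ev X1 p * E" by (intro cong_rules p)
  with c show ?thesis by (blast intro: cong_Idl_trans)
qed

lemma irreducible_imp_PEP_nonzero:
  assumes irr: "irreducible_representation (nw_algebra r u \<omega>) r \<rho>"
    and nz: "\<rho> (nw_E r u \<omega>) \<noteq> 0\<^sub>m r r" and kl: "k \<in> {1..r}" "l \<in> {1..r}"
  shows "P k * E * P l \<notin> I"
proof -
  define R where "R x = \<rho> (presented_class T x)" for x
  have irr': "irreducible_representation (presented_algebra T) r \<rho>"
    using irr by (simp add: nw_algebra_def)
  then have rep: "representation (presented_algebra T) r \<rho>"
    by (simp add: irreducible_representation_def)
  note RD = representation_presented_algebraD[OF rep, folded R_def]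
  have R_carrier [simp]: "R x \<in> carrier_mat r r" for x by (rule RD(1))
  have R_vec [simp]: "v \<in> carrier_vec r \<Longrightarrow> R x *\<^sub>v v \<in> carrier_vec r" for x v
    using RD(1) by (rule mult_mat_vec_carrier)
  have R_cong: "R x = R y" if "x \<approx> y" for x y
    using that by (simp add: R_def cong_Idl_def presented_class_eq_iff[symmetric])
  have R_mult: "R (x * y) *\<^sub>v v = R x *\<^sub>v (R y *\<^sub>v v)" if "v \<in> carrier_vec r" for x y v
    unfolding RD(3) by (rule assoc_mult_mat_vec[OF RD(1) RD(1) that])
  have R_scale: "R (scalar c * x) *\<^sub>v v = c \<cdot>\<^sub>v (R x *\<^sub>v v)" if "v \<in> carrier_vec r" for c x v
    unfolding RD(5) by (rule smult_mat_mult_vec[OF RD(1) that])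
  have R_add: "R (x + y) *\<^sub>v v = R x *\<^sub>v v + R y *\<^sub>v v" if "v \<in> carrier_vec r" for x y v
    unfolding RD(2) by (rule add_mult_distrib_mat_vec[OF RD(1) RD(1) that])
  have R_0: "R x *\<^sub>v v = 0\<^sub>v r" if "x \<approx> 0" "v \<in> carrier_vec r" for x v
    using R_scale[OF that(2), of 0 1] R_cong[OF that(1)] that(2) by (auto simp: RD(4))
  have cyclic: "\<exists>x. w = R x *\<^sub>v v" if "v \<in> carrier_vec r" "v \<noteq> 0\<^sub>v r" "w \<in> carrier_vec r" for v w
    using irreducible_representation_cyclic[OF irr' that] by (simp add: R_def)
  have RE: "\<not> (\<forall>v\<in>carrier_vec r. R E *\<^sub>v v = 0\<^sub>v r)"
    using nz mat_eq_0I[OF RD(1)[of E]] by (auto simp: R_def nw_E_def)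
  then obtain v0 where v0: "v0 \<in> carrier_vec r" "R E *\<^sub>v v0 \<noteq> 0\<^sub>v r" by blast

  have RP: "\<not> (\<forall>v\<in>carrier_vec r. R (P k) *\<^sub>v v = 0\<^sub>v r)" if k: "k \<in> {1..r}" for k
  proof
    assume 0: "\<forall>v\<in>carrier_vec r. R (P k) *\<^sub>v v = 0\<^sub>v r"
    interpret V: vec_space "TYPE('a)" r .
    define v where "v = R E *\<^sub>v v0"
    have v: "v \<in> carrier_vec r" "v \<noteq> 0\<^sub>v r" using v0 by (simp_all add: v_def)
    \<comment> \<open>Every vector has the form \<open>p(X1) v\<close>, a combination of the images
      of \<open>v\<close> under the \<open>P j\<close>. If \<open>P k\<close> acts as zero, at most
      \<open>r - 1\<close> of these remain, too few to span.\<close>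
    let ?B = "(\<lambda>j. R (P j) *\<^sub>v v) ` ({1..r} - {k})"
    have B: "?B \<subseteq> carrier_vec r" using v by auto
    have Bspan: "?B \<subseteq> V.span ?B" using V.in_own_span[of ?B] B by auto
    have sub: "submodule class_ring (V.span ?B) V.V"
      using V.span_is_submodule[of ?B] B by simp
    have zero: "0\<^sub>v r \<in> V.span ?B"
      using submodule.zero_closed[OF sub] by (simp add: module_vec_simps)
    have add: "x + y \<in> V.span ?B" if "x \<in> V.span ?B" "y \<in> V.span ?B" for x y
      using submodule.m_closed[OF sub that] by (simp add: module_vec_simps)
    have smult: "c \<cdot>\<^sub>v x \<in> V.span ?B" if "x \<in> V.span ?B" for c x
      using submodule.smult_closed[OF sub _ that, of c] by (simp add: module_vec_simps)
    have "w \<in> V.span ?B" if w: "w \<in> carrier_vec r" for w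
    proof -
      obtain x where x: "w = R x *\<^sub>v v" using cyclic v w by blast
      obtain p where p: "x * E \<approx> ev X1 p * E" using E_left by blast
      have sum: "R (\<Sum>j\<in>A. scalar (c j) * P j) *\<^sub>v v \<in> V.span ?B" if "A \<subseteq> {1..r}" for A c
        using finite_subset[OF that finite] that
      proof (induction A rule: finite_induct)
        case empty
        then show ?case using R_0[of 0 v] v zero by simp
      next
        case (insert j A)
        have "R (P j) *\<^sub>v v \<in> V.span ?B"
        proof (cases "j = k")
          case True
          then show ?thesis using 0 v zero by simp
        next
          case False
          then show ?thesis using insert.prems Bspan by blast
        qed
        then show ?case
          using insert v by (simp add: R_add R_scale add smult)
      qed
      have "w = R (x * E) *\<^sub>v v0" using v0 by (simp add: x v_def R_mult)
      also have "\<dots> = R (ev X1 p) *\<^sub>v v" using v0 R_cong[OF p] by (simp add: v_def R_mult)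
      also have "\<dots> = R (\<Sum>j\<in>{1..r}. scalar (poly p (u j)) * P j) *\<^sub>v v"
        using R_cong[OF ev_X1_sum] by simp
      finally show ?thesis using sum by simp
    qed
    then have "V.span ?B = carrier_vec r" using V.span_is_subset2[of ?B] B by auto
    then have "r \<le> card ?B"
      using V.gen_ge_dim[of ?B] V.dim_is_n B by simp
    also have "\<dots> \<le> card ({1..r} - {k})" by (intro card_image_le) simp
    also have "\<dots> < r" using k by simp
    finally show False by simp
  qed

  \<comment> \<open>Otherwise \<open>P k\<close> would kill everything generated by
    \<open>E w\<close>, because \<open>P k x E\<close> is a multiple of \<open>P k E\<close> for
    every \<open>x\<close>.\<close>
  have P_E: "R (P k) *\<^sub>v (R E *\<^sub>v w) \<noteq> 0\<^sub>v r"
    if w: "w \<in> carrier_vec r" "R E *\<^sub>v w \<noteq> 0\<^sub>v r" for w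
  proof
    assume 0: "R (P k) *\<^sub>v (R E *\<^sub>v w) = 0\<^sub>v r"
    have "R (P k) *\<^sub>v y = 0\<^sub>v r" if y: "y \<in> carrier_vec r" for y
    proof -
      obtain x where x: "y = R x *\<^sub>v (R E *\<^sub>v w)" using cyclic[OF R_vec[OF w(1)] w(2) y] by blast
      obtain c where c: "P k * x * E \<approx> scalar c * (P k * E)" using P_left_E kl by blast
      have "R (P k) *\<^sub>v y = R (P k * x * E) *\<^sub>v w" using w by (simp add: x R_mult)
      also have "\<dots> = c \<cdot>\<^sub>v (R (P k) *\<^sub>v (R E *\<^sub>v w))"
        by (simp only: R_cong[OF c], simp only: R_scale[OF w(1)], simp only: R_mult[OF w(1)])
      finally show ?thesis using 0 by auto
    qed
    then show False using RP kl by blast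
  qed
  \<comment> \<open>Dually: a vector \<open>P l w \<noteq> 0\<close> generates \<open>v0\<close>,
    and \<open>E x P l\<close> is a multiple of \<open>E P l\<close>, so \<open>E P l = 0\<close>
    would force \<open>E v0 = 0\<close>.\<close>
  have "\<exists>w\<in>carrier_vec r. R E *\<^sub>v (R (P l) *\<^sub>v w) \<noteq> 0\<^sub>v r"
  proof (rule ccontr)
    assume "\<not> ?thesis"
    then have 0: "R E *\<^sub>v (R (P l) *\<^sub>v w) = 0\<^sub>v r" if "w \<in> carrier_vec r" for w using that by blast
    obtain w where w: "w \<in> carrier_vec r" "R (P l) *\<^sub>v w \<noteq> 0\<^sub>v r" using RP kl by blast
    obtain x where x: "v0 = R x *\<^sub>v (R (P l) *\<^sub>v w)" using cyclic[OF R_vec[OF w(1)] w(2) v0(1)] by blast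
    obtain c where c: "E * x * P l \<approx> scalar c * (E * P l)" using P_right_E kl by blast
    have "R E *\<^sub>v v0 = R (E * x * P l) *\<^sub>v w" using w by (simp add: x R_mult)
    also have "\<dots> = c \<cdot>\<^sub>v (R E *\<^sub>v (R (P l) *\<^sub>v w))"
      by (simp only: R_cong[OF c], simp only: R_scale[OF w(1)], simp only: R_mult[OF w(1)])
    finally show False using 0[OF w(1)] v0 by auto
  qed
  then obtain w where w: "w \<in> carrier_vec r" "R E *\<^sub>v (R (P l) *\<^sub>v w) \<noteq> 0\<^sub>v r" by blast
  have "R (P k * E * P l) *\<^sub>v w \<noteq> 0\<^sub>v r"
    using P_E[of "R (P l) *\<^sub>v w"] w by (simp add: R_mult)
  then show ?thesis using R_0[of "P k * E * P l" w] w by (auto simp: cong_Idl_0_iff)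
qed

lemma PE_nonzero_imp_irreducible:
  assumes PE: "\<And>k. k \<in> {1..r} \<Longrightarrow> P k * E \<notin> I" and \<omega>0: "\<omega> 0 \<noteq> 0"
    and ss: "semisimple_algebra (nw_algebra r u \<omega>)"
  shows "\<exists>\<rho>. irreducible_representation (nw_algebra r u \<omega>) r \<rho> \<and> \<rho> (nw_E r u \<omega>) \<noteq> 0\<^sub>m r r"
proof -
  \<comment> \<open>Matrix indices start at \<open>0\<close>, the nodes at \<open>1\<close>.\<close>
  define p where "p j = P (Suc j)" for j
  have Suc_mem: "Suc j \<in> {1..r}" if "j < r" for j using that by simp
  have pE: "p j * E \<notin> I" if "j < r" for j
    unfolding p_def by (rule PE[OF Suc_mem[OF that]])
  have p_p: "p i * p j \<approx> scalar (if i = j then 1 else 0) * p i" if "i < r" "j < r" for i j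
    using P_P[OF Suc_mem Suc_mem, OF that] by (simp add: p_def)
  have p_sum: "1 \<approx> (\<Sum>j<r. p j)"
  proof -
    have "(\<Sum>i\<in>{1..r}. P i) = (\<Sum>j<r. p j)"
      unfolding p_def by (rule sum.reindex_bij_witness[of _ Suc "\<lambda>i. i - 1"]) auto
    then show ?thesis using P_sum by simp
  qed
  \<comment> \<open>The matrix entries of left multiplication by \<open>x\<close> on
    \<open>W E\<close> with respect to the basis \<open>p k * E\<close>. They exist by
    \<open>P_left_E\<close> and are unique because no \<open>p j * E\<close> vanishes.\<close>
  define co where "co j x k = (SOME c. p j * x * p k * E \<approx> scalar c * (p j * E))" for j x k
  have co: "p j * x * p k * E \<approx> scalar (co j x k) * (p j * E)" if "j < r" for j x k
  proof -
    have "\<exists>c. p j * (x * p k) * E \<approx> scalar c * (p j * E)"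
      unfolding p_def by (rule P_left_E[OF Suc_mem[OF that]])
    then have "\<exists>c. p j * x * p k * E \<approx> scalar c * (p j * E)"
      by (simp only: mult.assoc)
    then show ?thesis
      unfolding co_def by (rule someI_ex)
  qed
  have unique: "c = d" if "scalar c * (p j * E) \<approx> scalar d * (p j * E)" "j < r" for c d j
  proof (rule ccontr)
    assume "c \<noteq> d"
    have "scalar (c - d) * (p j * E) \<in> I"
      using that(1) scalar_add[of "c - d" d] by (simp add: cong_Idl_def algebra_simps)
    then show False
      using pE[OF that(2)] \<open>c \<noteq> d\<close> by (simp add: cong_Idl_scale_iff)
  qed
  have co_eqI: "co j x k = c" if "j < r" "p j * x * p k * E \<approx> scalar c * (p j * E)" for j x k c
    by (rule unique[OF cong_Idl_trans[OF cong_Idl_sym[OF co] that(2)] that(1)]) (rule that(1))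

  define R where "R x = mat r r (\<lambda>(j, k). co j x k)" for x
  obtain \<rho> where rep: "representation (presented_algebra T) r \<rho>" and \<rho>: "\<And>x. \<rho> (presented_class T x) = R x"
  proof (rule representation_presented_algebraI)
    fix x y assume xy: "x - y \<in> I"
    have "co j x k = co j y k" if "j < r" for j k
    proof (rule co_eqI[OF that])
      have "p j * x * p k * E \<approx> p j * y * p k * E"
        using xy by (intro cong_rules) (simp add: cong_Idl_def)
      then show "p j * x * p k * E \<approx> scalar (co j y k) * (p j * E)"
        using co[OF that] by (rule cong_Idl_trans)
    qed
    then show "R x = R y" by (auto simp: R_def)
  next
    show "R x \<in> carrier_mat r r" for x by (simp add: R_def)
  next
    fix x y
    have "co j (x + y) k = co j x k + co j y k" if "j < r" for j k
    proof (rule co_eqI[OF that])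
      have "p j * x * p k * E + p j * y * p k * E
        \<approx> scalar (co j x k) * (p j * E) + scalar (co j y k) * (p j * E)"
        by (intro cong_rules co that)
      then show "p j * (x + y) * p k * E \<approx> scalar (co j x k + co j y k) * (p j * E)"
        by (simp add: distrib_left distrib_right scalar_add)
    qed
    then show "R (x + y) = R x + R y" by (auto simp: R_def)
  next
    fix x y
    have "co j (x * y) k = (\<Sum>l<r. co j x l * co l y k)" if "j < r" for j k
    proof (rule co_eqI[OF that])
      \<comment> \<open>Inserting \<open>1\<close> as the sum of the idempotents between
        \<open>x\<close> and \<open>y\<close> produces the matrix product.\<close>
      have "p j * (x * y) * p k * E = p j * x * 1 * y * p k * E" by (simp add: mult.assoc)
      also have "\<dots> \<approx> p j * x * (\<Sum>l<r. p l) * y * p k * E"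
        by (intro cong_rules p_sum)
      also have "\<dots> = (\<Sum>l<r. p j * x * (p l * y * p k * E))"
        by (simp add: sum_distrib_left sum_distrib_right mult.assoc)
      also have "\<dots> \<approx> (\<Sum>l<r. p j * x * (scalar (co l y k) * (p l * E)))"
        by (intro cong_Idl_sum cong_rules co) simp
      also have "\<dots> = (\<Sum>l<r. scalar (co l y k) * (p j * x * p l * E))"
        by (intro sum.cong refl) (simp only: mult.assoc scalar_commute_left[of "p j"] scalar_commute_left[of x])
      also have "\<dots> \<approx> (\<Sum>l<r. scalar (co l y k) * (scalar (co j x l) * (p j * E)))"
        by (intro cong_Idl_sum cong_rules co that)
      also have "\<dots> = (\<Sum>l<r. scalar (co j x l * co l y k) * (p j * E))"
        by (simp add: mult.commute)
      also have "\<dots> = scalar (\<Sum>l<r. co j x l * co l y k) * (p j * E)"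
        by (rule fa.scale_sum_left[symmetric])
      finally show "p j * (x * y) * p k * E \<approx> scalar (\<Sum>l<r. co j x l * co l y k) * (p j * E)" .
    qed
    then show "R (x * y) = R x * R y"
      by (auto simp: R_def scalar_prod_def atLeast0LessThan)
  next
    have "co j 1 k = (if j = k then 1 else 0)" if "j < r" "k < r" for j k
    proof (rule co_eqI[OF that(1)])
      have "p j * p k * E \<approx> scalar (if j = k then 1 else 0) * p j * E"
        by (intro cong_rules p_p that)
      then show "p j * 1 * p k * E \<approx> scalar (if j = k then 1 else 0) * (p j * E)"
        by (simp add: mult.assoc)
    qed
    then show "R 1 = 1\<^sub>m r" by (auto simp: R_def)
  next
    fix c x
    have "co j (scalar c * x) k = c * co j x k" if "j < r" for j k
    proof (rule co_eqI[OF that])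
      have "scalar c * (p j * x * p k * E) \<approx> scalar c * (scalar (co j x k) * (p j * E))"
        by (intro cong_rules co that)
      then show "p j * (scalar c * x) * p k * E \<approx> scalar (c * co j x k) * (p j * E)"
        by (simp add: mult.assoc scalar_commute_left[of "p j"])
    qed
    then show "R (scalar c * x) = c \<cdot>\<^sub>m R x" by (auto simp: R_def)
  qed (rule that)

  \<comment> \<open>Identifies a vector \<open>v\<close> with the element of \<open>W E\<close>
    having coordinates \<open>v $ k\<close>, so that irreducibility can be proved inside the
    algebra.\<close>
  have R_vec: "R x *\<^sub>v v = vec r (\<lambda>j. d j)"
    if v: "v \<in> carrier_vec r"
      and d: "\<And>j. j < r \<Longrightarrow> p j * x * ((\<Sum>k<r. scalar (v $ k) * p k) * E) \<approx> scalar (d j) * (p j * E)"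
    for x v d
  proof (rule eq_vecI)
    fix j assume "j < dim_vec (vec r d)"
    then have j: "j < r" by simp
    have "scalar (\<Sum>k<r. co j x k * v $ k) * (p j * E) = (\<Sum>k<r. scalar (co j x k * v $ k) * (p j * E))"
      by (rule fa.scale_sum_left)
    also have "\<dots> = (\<Sum>k<r. scalar (v $ k) * (scalar (co j x k) * (p j * E)))"
      by (simp add: mult.commute)
    also have "\<dots> \<approx> (\<Sum>k<r. scalar (v $ k) * (p j * x * p k * E))"
      by (intro cong_Idl_sum cong_rules cong_Idl_sym[OF co] j)
    also have "\<dots> = p j * x * ((\<Sum>k<r. scalar (v $ k) * p k) * E)"
      unfolding sum_distrib_left sum_distrib_right
      by (intro sum.cong refl) (simp only: mult.assoc scalar_commute_left[of "p j"] scalar_commute_left[of x])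
    also have "\<dots> \<approx> scalar (d j) * (p j * E)" by (rule d[OF j])
    finally have "(\<Sum>k<r. co j x k * v $ k) = d j" by (rule unique[OF _ j])
    then show "(R x *\<^sub>v v) $ j = vec r d $ j"
      using j v by (simp add: R_def mult_mat_vec_def scalar_prod_def atLeast0LessThan)
  qed (simp add: R_def)

  have "irreducible_representation (presented_algebra T) r \<rho>"
    unfolding irreducible_representation_def
  proof (intro conjI allI impI, goal_cases)
    case 1
    show ?case by (rule rep)
  next
    case 2
    show ?case using r_pos by simp
  next
    case (3 U)
    then have sub: "submodule class_ring U (module_vec TYPE('a) r)"
      and stable: "\<And>x v. v \<in> U \<Longrightarrow> R x *\<^sub>v v \<in> U"
      by (auto simp: VectorSpace.subspace_def presented_algebra_carrier \<rho>)
    have U: "U \<subseteq> carrier_vec r" and U0: "0\<^sub>v r \<in> U"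
      using submodule.subset[OF sub] submodule.zero_closed[OF sub] by (simp_all add: module_vec_simps)
    show ?case
    proof (rule disjCI)
      assume neq: "U \<noteq> carrier_vec r"
      have "v = 0\<^sub>v r" if vU: "v \<in> U" for v
      proof (rule ccontr)
        assume nz: "v \<noteq> 0\<^sub>v r"
        have v: "v \<in> carrier_vec r" using U vU by blast
        define y where "y = (\<Sum>k<r. scalar (v $ k) * p k)"
        obtain j where j: "j < r" "v $ j \<noteq> 0" using nz v by (metis eq_vecI carrier_vecD index_zero_vec)
        have "p j * y \<approx> scalar (v $ j) * p j"
        proof -
          have "p j * y = (\<Sum>k<r. scalar (v $ k) * (p j * p k))"
            unfolding y_def sum_distrib_left by (intro sum.cong refl) (rule scalar_commute_left)
          also have "\<dots> \<approx> (\<Sum>k<r. scalar (v $ k) * (scalar (if j = k then 1 else 0) * p j))"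
            by (intro cong_Idl_sum cong_rules p_p j) simp
          also have "\<dots> = (\<Sum>k<r. if j = k then scalar (v $ k) * p j else 0)"
            by (intro sum.cong refl) simp
          also have "\<dots> = scalar (v $ j) * p j" using j by simp
          finally show ?thesis .
        qed
        then have pyE: "scalar (v $ j) * (p j * E) \<approx> p j * (y * E)"
          using cong_Idl_sym[OF cong_Idl_right[of T "p j * y" "scalar (v $ j) * p j" E]]
          by (simp only: mult.assoc)
        have "y * E \<notin> I"
        proof
          assume "y * E \<in> I"
          then have "p j * (y * E) \<approx> 0" unfolding cong_Idl_0_iff by (rule Idl_mult_left)
          with pyE have "scalar (v $ j) * (p j * E) \<approx> 0" by (rule cong_Idl_trans)
          then show False using pE j by (simp add: cong_Idl_0_iff cong_Idl_scale_iff)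
        qed
        \<comment> \<open>If no such \<open>w\<close> existed, semisimplicity would force
          \<open>y * E\<close> into the ideal.\<close>
        then obtain w where w: "(y * E) * w * (y * E) \<notin> I"
          using semisimple_presented_algebra[of T "y * E"] ss by (auto simp: nw_algebra_def)
        obtain c where c: "E * (w * y) * E \<approx> scalar c * E" using E_E by blast
        have "c \<noteq> 0"
        proof
          assume "c = 0"
          then have "E * (w * y) * E \<in> I" using c by (simp add: cong_Idl_0_iff)
          then show False using w Idl_mult_left[of "E * (w * y) * E" T y] by (simp add: mult.assoc)
        qed
        \<comment> \<open>Chosen so that left multiplication by \<open>z\<close> carries
          \<open>y * E\<close> to \<open>E\<close>.\<close>
        define z where "z = scalar (1 / c) * (E * w)"
        have "z * (y * E) = scalar (1 / c) * (E * (w * y) * E)"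
          by (simp add: z_def mult.assoc)
        also have "\<dots> \<approx> scalar (1 / c) * (scalar c * E)" by (intro cong_rules c)
        also have "\<dots> = E" using \<open>c \<noteq> 0\<close> by simp
        finally have z: "z * (y * E) \<approx> E" .
        have "t \<in> U" if t: "t \<in> carrier_vec r" for t
        proof -
          \<comment> \<open>From \<open>E\<close> the element with coordinates \<open>t\<close> is
            reached by multiplying with the corresponding combination of the
            \<open>p k\<close>.\<close>
          have "R ((\<Sum>k<r. scalar (t $ k) * p k) * z) *\<^sub>v v = vec r (\<lambda>j. t $ j)"
          proof (rule R_vec[OF v, folded y_def])
            fix j assume j: "j < r"
            have "p j * ((\<Sum>k<r. scalar (t $ k) * p k) * z) * (y * E)
              = (\<Sum>k<r. scalar (t $ k) * (p j * p k)) * (z * (y * E))"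
              by (simp add: mult.assoc sum_distrib_left sum_distrib_right scalar_commute_left[of "p j"])
            also have "\<dots> \<approx> (\<Sum>k<r. scalar (t $ k) * (scalar (if j = k then 1 else 0) * p j)) * E"
              by (intro cong_Idl_mult z cong_Idl_sum cong_Idl_left p_p j) simp
            also have "(\<Sum>k<r. scalar (t $ k) * (scalar (if j = k then 1 else 0) * p j))
              = (\<Sum>k<r. if j = k then scalar (t $ k) * p j else 0)"
              by (intro sum.cong refl) simp
            also have "\<dots> = scalar (t $ j) * p j" using j by simp
            finally show "p j * ((\<Sum>k<r. scalar (t $ k) * p k) * z) * (y * E) \<approx> scalar (t $ j) * (p j * E)"
              by (simp add: mult.assoc)
          qed
          moreover have "vec r (\<lambda>j. t $ j) = t" using t by auto
          ultimately show ?thesis using stable[OF vU] by metis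
        qed
        then show False using neq U by blast
      qed
      then show "U = {0\<^sub>v r}" using U0 by blast
    qed
  qed
  moreover have "R E \<noteq> 0\<^sub>m r r"
  proof
    assume 0: "R E = 0\<^sub>m r r"
    have "co j E k = 0" if "j < r" "k < r" for j k
      using arg_cong[OF 0, of "\<lambda>A. A $$ (j, k)"] that by (simp add: R_def)
    then have pEpE: "p j * E * p k * E \<approx> 0" if "j < r" "k < r" for j k
      using co[OF that(1), of E k] that by simp
    \<comment> \<open>Zero matrix entries say that all \<open>p 0 * E * p k * E\<close> vanish;
      summed over \<open>k\<close> this gives \<open>p 0 * E * E\<close>, which is
      \<open>\<omega> 0\<close> times the nonzero \<open>p 0 * E\<close>.\<close>
    have "p 0 * E * E = p 0 * E * 1 * E" by simp
    also have "\<dots> \<approx> p 0 * E * (\<Sum>k<r. p k) * E" by (intro cong_rules p_sum)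
    also have "\<dots> = (\<Sum>k<r. p 0 * E * p k * E)" by (simp add: sum_distrib_left sum_distrib_right)
    also have "\<dots> \<approx> (\<Sum>k<r. 0)" using r_pos by (intro cong_Idl_sum pEpE) auto
    finally have "p 0 * (E * E) \<approx> 0" by (simp add: mult.assoc)
    moreover have "scalar (\<omega> 0) * (p 0 * E) \<approx> p 0 * (E * E)"
      using cong_Idl_sym[OF cong_Idl_left[OF EE, of "p 0"]] by (simp add: scalar_commute_left[of "p 0"])
    ultimately have "scalar (\<omega> 0) * (p 0 * E) \<in> I"
      unfolding cong_Idl_0_iff[symmetric] by (rule cong_Idl_trans[rotated])
    then show False using pE[of 0] \<omega>0 r_pos by (simp add: cong_Idl_scale_iff)
  qed
  ultimately show ?thesis
    by (intro exI[of _ \<rho>]) (simp add: nw_algebra_def nw_E_def \<rho>)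
qed

lemma dim_iff:
  assumes \<omega>0: "\<omega> 0 \<noteq> 0" and ss: "semisimple_algebra (nw_algebra r u \<omega>)"
  shows "vectorspace.fin_dim class_ring (nw_algebra r u \<omega>) \<and>
      vectorspace.dim class_ring (nw_algebra r u \<omega>) = 3 * r ^ 2 \<longleftrightarrow>
    (\<exists>\<rho>. irreducible_representation (nw_algebra r u \<omega>) r \<rho> \<and> \<rho> (nw_E r u \<omega>) \<noteq> 0\<^sub>m r r)"
    (is "?dim \<longleftrightarrow> ?rep")
proof -
  have "?dim \<longleftrightarrow> (\<forall>k\<in>{1..r}. \<forall>l\<in>{1..r}. P k * E * P l \<notin> I)"
    unfolding nw_algebra_def card_J[symmetric] dim_presented_algebra_iff[OF finite_J M_UNIV] by (rule indep_iff)
  also have "\<dots> \<longleftrightarrow> ?rep"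
  proof
    assume PEP: "\<forall>k\<in>{1..r}. \<forall>l\<in>{1..r}. P k * E * P l \<notin> I"
    have "P k * E \<notin> I" if "k \<in> {1..r}" for k
      using PEP that Idl_mult_right[of "P k * E" T "P k"] by blast
    then show ?rep using \<omega>0 ss by (rule PE_nonzero_imp_irreducible)
  qed (use irreducible_imp_PEP_nonzero in blast)
  finally show ?thesis .
qed

end

section \<open>Differences of algebraically independent elements\<close>

text \<open>An equality would make \<open>u\<close> a zero of the polynomial
  \<open>x_i - x_j - c\<close> over \<open>F\<close>, which is nonzero since its three monomials are
  distinct.\<close>

lemma alg_independent_neq:
  assumes F: "subfield F class_ring" and ai: "alg_independent F N u"
    and ij: "i \<in> N" "j \<in> N" "i \<noteq> j" and c: "c \<in> F"
  shows "u i \<noteq> u j + c"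
proof
  assume eq: "u i = u j + c"
  have "subring F class_ring" using F by (simp add: subfield_def subdomain_def subcring_def)
  note sr = subringE[OF this]
  have F1: "0 \<in> F" "1 \<in> F" "- 1 \<in> F" "- c \<in> F"
    using sr(2,3) sr(5)[of 1] sr(5)[of c] c by (simp_all add: class_ring_simps)
  define x y :: "nat \<Rightarrow>\<^sub>0 nat" where "x = Poly_Mapping.single i 1" and "y = Poly_Mapping.single j 1"
  have dist: "x \<noteq> y" "x \<noteq> 0" "y \<noteq> 0"
    using ij by (auto simp: x_def y_def poly_mapping_eq_iff fun_eq_iff lookup_single when_def)
  define p where "p = Poly_Mapping.single x 1 + Poly_Mapping.single y (- 1) + Poly_Mapping.single 0 (- c)"
  have look: "Poly_Mapping.lookup p m = (if m = x then 1 else if m = y then - 1 else if m = 0 then - c else 0)" for m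
    using dist by (auto simp: p_def lookup_add lookup_single when_def)
  have keys: "Poly_Mapping.keys p \<subseteq> {x, y, 0}" by (auto simp: in_keys_iff look split: if_splits)
  have "mpoly_eval u p = (\<Sum>m\<in>{x, y, 0}. Poly_Mapping.lookup p m *
      (\<Prod>i\<in>Poly_Mapping.keys m. u i ^ Poly_Mapping.lookup m i))"
    unfolding mpoly_eval_def using keys by (intro sum.mono_neutral_left) (auto simp: in_keys_iff)
  also have "\<dots> = u i - u j - c"
    using dist by (simp add: look) (simp add: x_def y_def)
  finally have "mpoly_eval u p = 0" using eq by simp
  moreover have "\<forall>m. Poly_Mapping.lookup p m \<in> F" using F1 by (simp add: look)
  moreover have "\<forall>m\<in>Poly_Mapping.keys p. Poly_Mapping.keys m \<subseteq> N"
    using keys ij by (auto simp: x_def y_def)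
  ultimately have "p = 0" using ai unfolding alg_independent_def by blast
  then show False using look[of x] by simp
qed

theorem theorem3p4:
  fixes F :: "'a::field set" and r :: nat and u :: "nat \<Rightarrow> 'a" and \<omega> :: "nat \<Rightarrow> 'a"
  assumes "r \<ge> 1"
    and "subfield F class_ring"
    and "(2 :: 'a) \<noteq> 0"
    and "alg_independent F {1..r} u"
    and "generate_field class_ring (F \<union> u ` {1..r}) = (UNIV :: 'a set)"
    and "admissible \<omega>"
    and "\<omega> 0 \<noteq> 0"
    and "split_semisimple (nw_algebra r u \<omega>)"
  shows "vectorspace.fin_dim class_ring (nw_algebra r u \<omega>) \<and>
           vectorspace.dim class_ring (nw_algebra r u \<omega>) = 3 * r ^ 2 \<longleftrightarrow>
         (\<exists>\<rho>. irreducible_representation (nw_algebra r u \<omega>) r \<rho> \<and>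
              \<rho> (nw_E r u \<omega>) \<noteq> 0\<^sub>m r r)"
proof -
  have "subring F class_ring"
    using assms(2) by (simp add: subfield_def subdomain_def subcring_def)
  then have "0 \<in> F" "1 \<in> F" using subringE(2,3) by fastforce+
  then interpret nazarov_wenzl r u \<omega>
    using assms(1,3) alg_independent_neq[OF assms(2,4), of _ _ 0] alg_independent_neq[OF assms(2,4), of _ _ 1]
    by unfold_locales auto
  show ?thesis
    using assms(7,8) by (intro dim_iff) (simp_all add: split_semisimple_def)
qed

end
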